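(* Let $\mathcal{N} = \langle V_{min}, V_{max}, E, L\rangle$ be a finite minimax net. Given $\mathcal{N}$ as input, Algorithm 1 (written out in the context) returns the greatest correct marking of $\mathcal{N}$ under the Gödel semantics. Moreover, assuming that the nodes in $V_{min}$ are sorted according to $L$ and that the positive edges in $V_{min} \times V_{max}$ are sorted according to $E$, Algorithm 1 can be implemented to run in linear time in $m$ and $n$ (that is, in time $O(m+n)$), where $m = |E|$ is the number of positive edges of $\mathcal{N}$ and $n = |V_{min} \cup V_{max}|$.
   Context: Gödel structure on $[0,1]$: $a \land b = \min(a,b)$, $a \lor b = \max(a,b)$, $a \otimes b = \min(a,b)$, and $(a \Rightarrow b) = b$ if $a > b$, and $(a \Rightarrow b) = 1$ otherwise. Infima and suprema ($\bigwedge$, $\bigvee$) are taken in $[0,1]$ (so $\bigwedge\emptyset = 1$, $\bigvee\emptyset = 0$). A fuzzy subset of a set $X$ is a function $X \to [0,1]$; fuzzy subsets are ordered pointwise. A (fuzzy) minimax net is a structure $\mathcal{N} = \langle V_{min}, V_{max}, E, L\rangle$, where $V_{min}$ and $V_{max}$ are non-empty disjoint sets of nodes (min-nodes and max-nodes), $E: (V_{min} \times V_{max}) \cup (V_{max} \times V_{min}) \to [0,1]$ is a fuzzy set of edges, and $L: V_{min} \to [0,1]$ is the marking limit for min-nodes. One sets $E(x,y)=0$ for $\langle x,y\rangle \in (V_{min}\times V_{min}) \cup (V_{max} \times V_{max})$. A positive edge is a pair $\langle x,y\rangle \in (V_{min} \times V_{max}) \cup (V_{max} \times V_{min})$ with $E(x,y)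 > 0$; $|E|$ denotes the number of positive edges. A marking of $\mathcal{N}$ is a function $M: V_{min} \cup V_{max} \to [0,1]$. It is a correct marking if for every $x \in V_{min}$ and $y \in V_{max}$: $M(x) \leq L(x)$; $M(x) \leq \bigwedge_{z \in V_{max}} (E(z,x) \Rightarrow M(z))$; and $M(y) \leq \bigvee_{z \in V_{min}} (E(z,y) \otimes M(z))$. The greatest correct marking is the correct marking that is pointwise greater than or equal to every correct marking. Notation: $V = V_{min}\cup V_{max}$, $\mathit{Succ}(x) = \{y \in V \mid E(x,y)>0\}$, $\mathit{Pred}(x) = \{y\in V \mid E(y,x)>0\}$. Algorithm 1 (input: a finite minimax net $\mathcal{N}$; it maintains a marking $M$, Boolean flags $x.\mathit{done}$ for $x \in V_{min}$ and $\langle z,y\rangle.\mathit{done}$ for positive edges $\langle z,y\rangle \in V_{min}\times V_{max}$, counters $y.\mathit{count}$ for $y \in V_{max}$, and a priority queue $Q$ of nodes and edges in which smaller keys have higher priority; a node may occur in $Q$ several times, and each occurrence keeps the key it was inserted with). Initialization: $Q$ is empty. For each $x \in V_{min}$: $M(x) := L(x)$, $x.\mathit{done} := \mathit{false}$, insert $x$ into $Q$ with key $M(x)$. For each $y \in V_{max}$: $M(y) := 0$, $y.\mathit{count} := |\mathit{Pred}(y)|$, and if $y.\mathit{count} = 0$ insert $y$ into $Q$ with key $M(y)$. For each $\langle z,y\rangle \in V_{min}\times V_{max}$ with $E(z,y) > 0$: $\langle z,y\rangle.\mathit{done} := \mathit{false}$, insert $\langle z,y\rangle$ into $Q$ with key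 $E(z,y)$. Main loop: while $Q$ is not empty, extract from $Q$ an object $\mathit{obj}$ (an occurrence with smallest key, ties broken arbitrarily), and: (1) if $\mathit{obj}$ is a node $z \in V_{max}$: for each $x \in \mathit{Succ}(z)$ with $\lnot x.\mathit{done}$ and $E(z,x) > M(z)$, set $M(x) := M(z)$ and insert $x$ into $Q$ with key $M(x)$; (2) else if $\mathit{obj}$ is a node $z \in V_{min}$ with $\lnot z.\mathit{done}$: for each $y \in \mathit{Succ}(z)$ with $\lnot\langle z,y\rangle.\mathit{done}$, set $M(y) := M(z)$, $\langle z,y\rangle.\mathit{done} := \mathit{true}$, $y.\mathit{count} := y.\mathit{count}-1$, and if $y.\mathit{count}=0$ insert $y$ into $Q$ with key $M(y)$; after this, set $z.\mathit{done} := \mathit{true}$; (3) else if $\mathit{obj}$ is an edge $\langle z,y\rangle$ with $\lnot\langle z,y\rangle.\mathit{done}$: set $M(y) := E(z,y)$, $\langle z,y\rangle.\mathit{done} := \mathit{true}$, $y.\mathit{count} := y.\mathit{count}-1$, and if $y.\mathit{count} = 0$ insert $y$ into $Q$ with key $M(y)$. (Otherwise the extracted object is ignored.) When the loop terminates, return $M$. *)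

theory Defs
  imports Complex_Main "HOL-Library.Multiset"
begin

section \<open>Minimax nets and their greatest correct marking\<close>

record 'v net =
  Vmin :: "'v set"
  Vmax :: "'v set"
  wt :: "'v \<Rightarrow> 'v \<Rightarrow> real"  \<comment> \<open>the fuzzy edge relation \<open>E\<close>\<close>
  lim :: "'v \<Rightarrow> real"  \<comment> \<open>the marking limit \<open>L\<close>\<close>

definition nodes :: "'v net \<Rightarrow> 'v set" where
  "nodes N = Vmin N \<union> Vmax N"

definition minimax_net :: "'v net \<Rightarrow> bool" where
  "minimax_net N \<longleftrightarrow>
     Vmin N \<noteq> {} \<and> Vmax N \<noteq> {} \<and> Vmin N \<inter> Vmax N = {} \<and>
     (\<forall>(x, y) \<in> Vmin N \<times> Vmax N \<union> Vmax N \<times> Vmin N. 0 \<le> wt N x y \<and> wt N x y \<le> 1) \<and>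
     (\<forall>(x, y) \<in> Vmin N \<times> Vmin N \<union> Vmax N \<times> Vmax N. wt N x y = 0) \<and>
     (\<forall>x \<in> Vmin N. 0 \<le> lim N x \<and> lim N x \<le> 1)"

definition finite_minimax_net :: "'v net \<Rightarrow> bool" where
  "finite_minimax_net N \<longleftrightarrow> minimax_net N \<and> finite (nodes N)"

definition pos_edges :: "'v net \<Rightarrow> ('v \<times> 'v) set" where
  "pos_edges N =
     {(x, y) \<in> Vmin N \<times> Vmax N \<union> Vmax N \<times> Vmin N. wt N x y > 0}"

definition Succ :: "'v net \<Rightarrow> 'v \<Rightarrow> 'v set" where
  "Succ N x = {y \<in> nodes N. wt N x y > 0}"

definition Pred :: "'v net \<Rightarrow> 'v \<Rightarrow> 'v set" where
  "Pred N x = {y \<in> nodes N. wt N y x > 0}"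

definition godel_and :: "real \<Rightarrow> real \<Rightarrow> real" where
  "godel_and a b = min a b"

definition godel_imp :: "real \<Rightarrow> real \<Rightarrow> real" where
  "godel_imp a b = (if a > b then b else 1)"

text \<open>Markings are functions on all of \<open>'v\<close>; only their values on \<open>nodes N\<close> are
  constrained and compared.\<close>

definition marking :: "'v net \<Rightarrow> ('v \<Rightarrow> real) \<Rightarrow> bool" where
  "marking N M \<longleftrightarrow> (\<forall>v \<in> nodes N. 0 \<le> M v \<and> M v \<le> 1)"

text \<open>The index sets \<open>Vmax N\<close> and \<open>Vmin N\<close> are nonempty and all values lie in \<open>[0,1]\<close>, so the
  infimum and supremum in \<open>real\<close> are those in \<open>[0,1]\<close>.\<close>

definition correct_marking :: "'v net \<Rightarrow> ('v \<Rightarrow> real) \<Rightarrow> bool" where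
  "correct_marking N M \<longleftrightarrow> marking N M \<and>
     (\<forall>x \<in> Vmin N. M x \<le> lim N x) \<and>
     (\<forall>x \<in> Vmin N. M x \<le> (INF z \<in> Vmax N. godel_imp (wt N z x) (M z))) \<and>
     (\<forall>y \<in> Vmax N. M y \<le> (SUP z \<in> Vmin N. godel_and (wt N z y) (M z)))"

definition greatest_correct_marking :: "'v net \<Rightarrow> ('v \<Rightarrow> real) \<Rightarrow> bool" where
  "greatest_correct_marking N M \<longleftrightarrow> correct_marking N M \<and>
     (\<forall>M'. correct_marking N M' \<longrightarrow> (\<forall>v \<in> nodes N. M' v \<le> M v))"


section \<open>The algorithm as a nondeterministic transition system\<close>

datatype 'v obj = Node 'v | Edge 'v 'v

text \<open>The priority queue is the multiset of pairs (object, key at insertion).\<close>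

record 'v alg_state =
  mark :: "'v \<Rightarrow> real"
  node_done :: "'v \<Rightarrow> bool"
  edge_done :: "'v \<times> 'v \<Rightarrow> bool"
  cnt :: "'v \<Rightarrow> nat"
  queue :: "('v obj \<times> real) multiset"

definition init_state :: "'v net \<Rightarrow> 'v alg_state" where
  "init_state N =
     \<lparr> mark = (\<lambda>v. if v \<in> Vmin N then lim N v else 0),
       node_done = (\<lambda>_. False),
       edge_done = (\<lambda>_. False),
       cnt = (\<lambda>y. card (Pred N y)),
       queue =
         image_mset (\<lambda>x. (Node x, lim N x)) (mset_set (Vmin N)) +
         image_mset (\<lambda>y. (Node y, 0)) (mset_set {y \<in> Vmax N. card (Pred N y) = 0}) +
         image_mset (\<lambda>(z, y). (Edge z y, wt N z y))
           (mset_set {(z, y) \<in> Vmin N \<times> Vmax N. wt N z y > 0}) \<rparr>"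

definition insert_node :: "'v \<Rightarrow> 'v alg_state \<Rightarrow> 'v alg_state" where
  "insert_node v s = s\<lparr>queue := add_mset (Node v, mark s v) (queue s)\<rparr>"

text \<open>The loop body of case (1), for a max-node \<open>z\<close> and one \<open>x \<in> Succ N z\<close>.\<close>

definition lower :: "'v net \<Rightarrow> 'v \<Rightarrow> 'v \<Rightarrow> 'v alg_state \<Rightarrow> 'v alg_state" where
  "lower N z x s =
     (if \<not> node_done s x \<and> wt N z x > mark s z
      then insert_node x (s\<lparr>mark := (mark s)(x := mark s z)\<rparr>)
      else s)"

text \<open>The instructions shared by cases (2) and (3), guarded by the edge flag; the new mark \<open>k\<close>
  of \<open>y\<close> is \<open>M(z)\<close> in case (2) and \<open>E(z,y)\<close> in case (3).\<close>

definition settle :: "'v \<Rightarrow> 'v \<Rightarrow> real \<Rightarrow> 'v alg_state \<Rightarrow> 'v alg_state" where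
  "settle z y k s =
     (if edge_done s (z, y) then s
      else
        (let s' = s\<lparr>mark := (mark s)(y := k),
                    edge_done := (edge_done s)((z, y) := True),
                    cnt := (cnt s)(y := cnt s y - 1)\<rparr>
         in if cnt s' y = 0 then insert_node y s' else s'))"

text \<open>The list \<open>vs\<close> is the order in which the ``for each'' loop visits \<open>Succ N z\<close>.\<close>

definition process_node :: "'v net \<Rightarrow> 'v \<Rightarrow> 'v list \<Rightarrow> 'v alg_state \<Rightarrow> 'v alg_state" where
  "process_node N z vs s =
     (if z \<in> Vmax N then fold (lower N z) vs s
      else if \<not> node_done s z then
        (let s' = fold (\<lambda>y t. settle z y (mark t z) t) vs s
         in s'\<lparr>node_done := (node_done s')(z := True)\<rparr>)
      else s)"

definition pop_min :: "'v alg_state \<Rightarrow> 'v obj \<Rightarrow> 'v alg_state \<Rightarrow> bool" where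
  "pop_min s ob s' \<longleftrightarrow>
     (\<exists>k. (ob, k) \<in># queue s \<and> (\<forall>(ob', k') \<in># queue s. k \<le> k') \<and>
          s' = s\<lparr>queue := queue s - {#(ob, k)#}\<rparr>)"

text \<open>One iteration of the main loop.  Both the choice among entries with smallest key and the
  order of the inner loops are arbitrary.\<close>

inductive alg_step :: "'v net \<Rightarrow> 'v alg_state \<Rightarrow> 'v alg_state \<Rightarrow> bool" for N where
  node: "pop_min s (Node z) s' \<Longrightarrow> distinct vs \<Longrightarrow> set vs = Succ N z \<Longrightarrow>
           alg_step N s (process_node N z vs s')"
| edge: "pop_min s (Edge z y) s' \<Longrightarrow> alg_step N s (settle z y (wt N z y) s')"

definition alg_terminates :: "'v net \<Rightarrow> bool" where
  "alg_terminates N \<longleftrightarrow>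
     \<not> (\<exists>s. s 0 = init_state N \<and> (\<forall>i. alg_step N (s i) (s (Suc i))))"

text \<open>The second clause covers every maximal run, and so also says that the loop never gets
  stuck with a nonempty queue.\<close>

definition alg_returns_greatest :: "'v net \<Rightarrow> bool" where
  "alg_returns_greatest N \<longleftrightarrow> alg_terminates N \<and>
     (\<forall>s. (alg_step N)\<^sup>*\<^sup>* (init_state N) s \<and> (\<nexists>s'. alg_step N s s') \<longrightarrow>
          queue s = {#} \<and> greatest_correct_marking N (mark s))"


section \<open>The machine model\<close>

text \<open>A random access machine with a structured control flow and unit-cost instructions.  It has
  registers and unbounded arrays of two sorts: naturals (indices and flags), on which it can only
  form successors and predecessors and compare, and reals (marks and weights), which it can only
  copy and compare.  Hence \<open>t\<close> steps increase no natural beyond those of the input and of the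
  program by more than \<open>t\<close>, and no information can be packed into a register by arithmetic.
  Registers and arrays of each sort are named by numbers; a program mentions finitely many.\<close>

record mem =
  nreg :: "nat \<Rightarrow> nat"
  rreg :: "nat \<Rightarrow> real"
  narr :: "nat \<Rightarrow> nat \<Rightarrow> nat"
  rarr :: "nat \<Rightarrow> nat \<Rightarrow> real"

datatype instr =
    NConst nat nat     \<comment> \<open>register, constant\<close>
  | NCopy nat nat      \<comment> \<open>target, source\<close>
  | NInc nat
  | NDec nat
  | NLoad nat nat nat  \<comment> \<open>target, array, index register\<close>
  | NStore nat nat nat \<comment> \<open>array, index register, source\<close>
  | RZero nat
  | RCopy nat nat
  | RLoad nat nat nat
  | RStore nat nat nat

datatype test = NLess nat nat | NEq nat nat | RLess nat nat

datatype prog =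
    Skip
  | Do instr
  | Seq prog prog
  | Cond test prog prog
  | While test prog

fun exec :: "instr \<Rightarrow> mem \<Rightarrow> mem" where
  "exec (NConst i k) \<sigma> = \<sigma>\<lparr>nreg := (nreg \<sigma>)(i := k)\<rparr>"
| "exec (NCopy i j) \<sigma> = \<sigma>\<lparr>nreg := (nreg \<sigma>)(i := nreg \<sigma> j)\<rparr>"
| "exec (NInc i) \<sigma> = \<sigma>\<lparr>nreg := (nreg \<sigma>)(i := nreg \<sigma> i + 1)\<rparr>"
| "exec (NDec i) \<sigma> = \<sigma>\<lparr>nreg := (nreg \<sigma>)(i := nreg \<sigma> i - 1)\<rparr>"
| "exec (NLoad i a j) \<sigma> = \<sigma>\<lparr>nreg := (nreg \<sigma>)(i := narr \<sigma> a (nreg \<sigma> j))\<rparr>"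
| "exec (NStore a j i) \<sigma> =
     \<sigma>\<lparr>narr := (narr \<sigma>)(a := (narr \<sigma> a)(nreg \<sigma> j := nreg \<sigma> i))\<rparr>"
| "exec (RZero i) \<sigma> = \<sigma>\<lparr>rreg := (rreg \<sigma>)(i := 0)\<rparr>"
| "exec (RCopy i j) \<sigma> = \<sigma>\<lparr>rreg := (rreg \<sigma>)(i := rreg \<sigma> j)\<rparr>"
| "exec (RLoad i a j) \<sigma> = \<sigma>\<lparr>rreg := (rreg \<sigma>)(i := rarr \<sigma> a (nreg \<sigma> j))\<rparr>"
| "exec (RStore a j i) \<sigma> =
     \<sigma>\<lparr>rarr := (rarr \<sigma>)(a := (rarr \<sigma> a)(nreg \<sigma> j := rreg \<sigma> i))\<rparr>"

fun holds :: "test \<Rightarrow> mem \<Rightarrow> bool" where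
  "holds (NLess i j) \<sigma> \<longleftrightarrow> nreg \<sigma> i < nreg \<sigma> j"
| "holds (NEq i j) \<sigma> \<longleftrightarrow> nreg \<sigma> i = nreg \<sigma> j"
| "holds (RLess i j) \<sigma> \<longleftrightarrow> rreg \<sigma> i < rreg \<sigma> j"

text \<open>Small-step semantics; the machine has halted when the remaining program is \<open>Skip\<close>, which
  is the only program that steps to itself.\<close>

fun small_step :: "prog \<times> mem \<Rightarrow> prog \<times> mem" where
  "small_step (Skip, \<sigma>) = (Skip, \<sigma>)"
| "small_step (Do ins, \<sigma>) = (Skip, exec ins \<sigma>)"
| "small_step (Seq p q, \<sigma>) =
     (if p = Skip then (q, \<sigma>)
      else (let (p', \<sigma>') = small_step (p, \<sigma>) in (Seq p' q, \<sigma>')))"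
| "small_step (Cond b p q, \<sigma>) = (if holds b \<sigma> then p else q, \<sigma>)"
| "small_step (While b p, \<sigma>) = (if holds b \<sigma> then Seq p (While b p) else Skip, \<sigma>)"

definition config_after :: "nat \<Rightarrow> prog \<Rightarrow> mem \<Rightarrow> prog \<times> mem" where
  "config_after t p \<sigma> = (small_step ^^ t) (p, \<sigma>)"


section \<open>Linear-time implementations\<close>

text \<open>An input presents the nodes as the numbers below \<open>n\<close> through an arbitrary numbering
  \<open>code\<close>, lists \<open>xs\<close> of the min-nodes sorted by \<open>L\<close>, \<open>ys\<close> of the max-nodes, \<open>es\<close> of the
  positive edges from min- to max-nodes sorted by \<open>E\<close>, and \<open>fs\<close> of the positive edges from max-
  to min-nodes.  No order is assumed on \<open>ys\<close> and \<open>fs\<close>, and no adjacency structure is given.\<close>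

definition presentation ::
  "'v net \<Rightarrow> ('v \<Rightarrow> nat) \<Rightarrow> 'v list \<Rightarrow> 'v list \<Rightarrow> ('v \<times> 'v) list \<Rightarrow> ('v \<times> 'v) list \<Rightarrow> bool" where
  "presentation N code xs ys es fs \<longleftrightarrow>
     bij_betw code (nodes N) {..<card (nodes N)} \<and>
     distinct xs \<and> set xs = Vmin N \<and> sorted (map (lim N) xs) \<and>
     distinct ys \<and> set ys = Vmax N \<and>
     distinct es \<and> set es = pos_edges N \<inter> Vmin N \<times> Vmax N \<and>
     sorted (map (\<lambda>(z, y). wt N z y) es) \<and>
     distinct fs \<and> set fs = pos_edges N \<inter> Vmax N \<times> Vmin N"

text \<open>Everything in the initial memory that is not mentioned here is arbitrary.\<close>

definition input_memory ::
  "'v net \<Rightarrow> ('v \<Rightarrow> nat) \<Rightarrow> 'v list \<Rightarrow> 'v list \<Rightarrow> ('v \<times> 'v) list \<Rightarrow> ('v \<times> 'v) list \<Rightarrow> mem \<Rightarrow> bool"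
where
  "input_memory N code xs ys es fs \<sigma> \<longleftrightarrow>
     nreg \<sigma> 0 = length xs \<and> nreg \<sigma> 1 = length ys \<and>
     nreg \<sigma> 2 = length es \<and> nreg \<sigma> 3 = length fs \<and>
     (\<forall>i < length xs. narr \<sigma> 0 i = code (xs ! i) \<and> rarr \<sigma> 0 i = lim N (xs ! i)) \<and>
     (\<forall>i < length ys. narr \<sigma> 1 i = code (ys ! i)) \<and>
     (\<forall>i < length es. narr \<sigma> 2 i = code (fst (es ! i)) \<and> narr \<sigma> 3 i = code (snd (es ! i)) \<and>
        rarr \<sigma> 1 i = wt N (fst (es ! i)) (snd (es ! i))) \<and>
     (\<forall>i < length fs. narr \<sigma> 4 i = code (fst (fs ! i)) \<and> narr \<sigma> 5 i = code (snd (fs ! i)) \<and>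
        rarr \<sigma> 2 i = wt N (fst (fs ! i)) (snd (fs ! i)))"

text \<open>The arrays \<open>aM\<close>, \<open>aD\<close>, \<open>aF\<close>, \<open>aC\<close> hold the marking, the node flags, the edge flags and the
  counters of the state \<open>s\<close>; flags are \<open>0\<close> or \<open>1\<close>, and edges are addressed by their position
  in \<open>es\<close>.  How the queue is stored is left to the implementation.\<close>

definition represents ::
  "'v net \<Rightarrow> ('v \<Rightarrow> nat) \<Rightarrow> ('v \<times> 'v) list \<Rightarrow> nat \<Rightarrow> nat \<Rightarrow> nat \<Rightarrow> nat \<Rightarrow> mem \<Rightarrow> 'v alg_state \<Rightarrow> bool"
where
  "represents N code es aM aD aF aC \<sigma> s \<longleftrightarrow>
     (\<forall>v \<in> nodes N. rarr \<sigma> aM (code v) = mark s v) \<and>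
     (\<forall>x \<in> Vmin N. narr \<sigma> aD (code x) = of_bool (node_done s x)) \<and>
     (\<forall>i < length es. narr \<sigma> aF i = of_bool (edge_done s (es ! i))) \<and>
     (\<forall>y \<in> Vmax N. narr \<sigma> aC (code y) = cnt s y)"

text \<open>Started in \<open>\<sigma>\<close>, the program \<open>p\<close> halts within \<open>T\<close> steps, and its execution follows a complete
  run \<open>s 0, \<dots>, s k\<close> of the algorithm: at increasing times \<open>t 0 < \<dots> < t k\<close> its memory represents
  these states, and it halts with the memory representing the last one.\<close>

definition implements_run ::
  "prog \<Rightarrow> nat \<Rightarrow> nat \<Rightarrow> nat \<Rightarrow> nat \<Rightarrow> 'v net \<Rightarrow> ('v \<Rightarrow> nat) \<Rightarrow> ('v \<times> 'v) list \<Rightarrow> mem \<Rightarrow> nat \<Rightarrow> bool"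
where
  "implements_run p aM aD aF aC N code es \<sigma> T \<longleftrightarrow>
     (\<exists>k s t.
        s 0 = init_state N \<and> (\<forall>i < k. alg_step N (s i) (s (Suc i))) \<and> queue (s k) = {#} \<and>
        (\<forall>i < k. t i < t (Suc i)) \<and> t k \<le> T \<and>
        (\<forall>i \<le> k. represents N code es aM aD aF aC (snd (config_after (t i) p \<sigma>)) (s i)) \<and>
        fst (config_after T p \<sigma>) = Skip \<and>
        represents N code es aM aD aF aC (snd (config_after T p \<sigma>)) (s k))"

end

theory Submission
  imports Defs
begin

text \<open>Keys are extracted in nondecreasing order: every key inserted during the loop equals the key
  \<open>k\<close> just extracted.  Marks of max-nodes and of finished min-nodes never exceed \<open>k\<close>, all other
  min-nodes still have their mark as a key in the queue.  Hence a node or edge is handled when the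
  value it contributes is final, marks always stay above every correct marking, and once the queue
  is empty the marking is itself correct.  A single potential, which charges every node its pending
  outgoing edges, decreases with each iteration by at least the work done; this gives both
  termination and the linear time bound.\<close>

section \<open>Invariants and potential of the algorithm\<close>

text \<open>Two one-sided facts are carried along together. Every max-node mark always has a
  supporting min-node and every min-node mark respects \<open>L\<close>, so the only conditions of
  correctness that can fail during the run are those along edges from max-nodes to min-nodes; they
  are repaired when the max-node is extracted with counter 0. Maximality is the opposite inequality.
  A max-node starts at 0 and is overwritten while its counter runs down, so at first it only bounds
  the contributions of its settled edges, and it dominates other correct markings only once the
  counter is 0. Two obstacles shape the proof. A lowered min-node leaves older entries with larger
  keys in the queue. And the invariant fails between an extraction and the end of the inner loop, so
  each inner loop is treated as one simultaneous update. In the potential, the scan of a min-node is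
  charged to the node and not to its entries, because only its first extraction triggers the scan; a
  max-node is queued once, so its entry can carry all its costs.\<close>

locale minimax =
  fixes N :: "'v net"
  assumes fin_net: "finite_minimax_net N"
begin

lemma fin_Vmin [simp]: "finite (Vmin N)" and fin_Vmax [simp]: "finite (Vmax N)"
  and Vmin_ne: "Vmin N \<noteq> {}" and Vmax_ne: "Vmax N \<noteq> {}"
  and Vmin_Vmax: "x \<in> Vmin N \<Longrightarrow> x \<notin> Vmax N"
  and Vmax_Vmin: "x \<in> Vmax N \<Longrightarrow> x \<notin> Vmin N"
  and wt_min_max: "\<lbrakk>x \<in> Vmin N; y \<in> Vmax N\<rbrakk> \<Longrightarrow> 0 \<le> wt N x y \<and> wt N x y \<le> 1"
  and wt_min_min: "\<lbrakk>x \<in> Vmin N; y \<in> Vmin N\<rbrakk> \<Longrightarrow> wt N x y = 0"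
  and wt_max_max: "\<lbrakk>x \<in> Vmax N; y \<in> Vmax N\<rbrakk> \<Longrightarrow> wt N x y = 0"
  and lim_bounds: "x \<in> Vmin N \<Longrightarrow> 0 \<le> lim N x \<and> lim N x \<le> 1"
  using fin_net unfolding finite_minimax_net_def minimax_net_def nodes_def by auto

lemma Succ_min: "z \<in> Vmin N \<Longrightarrow> Succ N z = {y \<in> Vmax N. wt N z y > 0}"
  using wt_min_min by (fastforce simp: Succ_def nodes_def)

lemma Succ_max: "z \<in> Vmax N \<Longrightarrow> Succ N z = {x \<in> Vmin N. wt N z x > 0}"
  using wt_max_max by (fastforce simp: Succ_def nodes_def)

lemma Pred_max: "y \<in> Vmax N \<Longrightarrow> Pred N y = {z \<in> Vmin N. wt N z y > 0}"
  using wt_max_max by (fastforce simp: Pred_def nodes_def)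

lemma finite_Succ [simp]: "finite (Succ N z)" and finite_Pred [simp]: "finite (Pred N z)"
  by (auto simp: Succ_def Pred_def nodes_def)

text \<open>The net is finite, so infimum and supremum are attained and become a bounded quantifier
  each. A Goedel implication with value 1 imposes nothing, because \<open>M x\<close> is at most
  1.\<close>

lemma correct_marking_iff:
  "correct_marking N M \<longleftrightarrow> marking N M \<and>
     (\<forall>x \<in> Vmin N. M x \<le> lim N x) \<and>
     (\<forall>x \<in> Vmin N. \<forall>z \<in> Vmax N. M z < wt N z x \<longrightarrow> M x \<le> M z) \<and>
     (\<forall>y \<in> Vmax N. \<exists>z \<in> Vmin N. M y \<le> wt N z y \<and> M y \<le> M z)"
proof -
  have inf: "M x \<le> (INF z \<in> Vmax N. godel_imp (wt N z x) (M z)) \<longleftrightarrow>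
      (\<forall>z \<in> Vmax N. M z < wt N z x \<longrightarrow> M x \<le> M z)" if "marking N M" "x \<in> Vmin N" for x
  proof -
    have "M x \<le> 1" using that by (auto simp: marking_def nodes_def)
    moreover have "M x \<le> (INF z \<in> Vmax N. godel_imp (wt N z x) (M z)) \<longleftrightarrow>
        (\<forall>z \<in> Vmax N. M x \<le> godel_imp (wt N z x) (M z))"
      using Vmax_ne by (simp add: cInf_eq_Min)
    ultimately show ?thesis by (simp only:) (auto simp: godel_imp_def)
  qed
  have sup: "M y \<le> (SUP z \<in> Vmin N. godel_and (wt N z y) (M z)) \<longleftrightarrow>
      (\<exists>z \<in> Vmin N. M y \<le> wt N z y \<and> M y \<le> M z)" for y
    using Vmin_ne by (subst cSup_eq_Max) (auto simp: godel_and_def Max_ge_iff)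
  show ?thesis unfolding correct_marking_def using inf sup by blast
qed

text \<open>One unit pays for the extraction of the entry. The two further units per outgoing edge
  of a max-node pay for scanning the edge and for the min-node entry, of weight 1, that the scan may
  insert.\<close>

definition weight :: "'v obj \<Rightarrow> nat" where
  "weight ob = (case ob of
     Node v \<Rightarrow> if v \<in> Vmax N then 1 + 2 * card (Succ N v) else 1 | Edge _ _ \<Rightarrow> 1)"

text \<open>Future work is prepaid: the second sum covers the single scan of each unfinished
  min-node, the third the entry that a max-node receives when its counter reaches 0.\<close>

definition potential :: "'v alg_state \<Rightarrow> nat" where
  "potential s = (\<Sum>(ob, _) \<in># queue s. weight ob) +
     (\<Sum>x \<in> {x \<in> Vmin N. \<not> node_done s x}. card (Succ N x)) +
     (\<Sum>y \<in> {y \<in> Vmax N. cnt s y > 0}. weight (Node y))"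

end

text \<open>\<open>k\<close> is the key extracted last, or 0 before the first extraction.
  \<open>queue_node\<close> admits outdated entries of min-nodes as long as their keys are not below
  the mark. By \<open>cnt_0\<close>, a max-node with counter 0 either still waits in the queue or
  already has its conditions on min-nodes satisfied. \<open>mark_bounds\<close>,
  \<open>mark_lim\<close> and \<open>max_support\<close> are the part of correctness that never
  fails; \<open>min_above\<close> and \<open>edge_above\<close> lead to maximality.\<close>

locale alg_inv = minimax N for N :: "'v net" +
  fixes s :: "'v alg_state" and k :: real
  assumes k_nonneg: "0 \<le> k"
    and k_le: "(ob, k') \<in># queue s \<Longrightarrow> k \<le> k'"
    and queue_node: "(Node v, k') \<in># queue s \<Longrightarrow>
          v \<in> Vmin N \<and> (\<not> node_done s v \<longrightarrow> mark s v \<le> k') \<or>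
          v \<in> Vmax N \<and> cnt s v = 0 \<and> mark s v = k'"
    and queue_edge: "(Edge z y, k') \<in># queue s \<Longrightarrow>
          z \<in> Vmin N \<and> y \<in> Vmax N \<and> 0 < wt N z y \<and> k' = wt N z y"
    and undone_node: "\<lbrakk>x \<in> Vmin N; \<not> node_done s x\<rbrakk> \<Longrightarrow> (Node x, mark s x) \<in># queue s"
    and undone_edge: "\<lbrakk>z \<in> Vmin N; y \<in> Vmax N; 0 < wt N z y; \<not> edge_done s (z, y)\<rbrakk> \<Longrightarrow>
          (Edge z y, wt N z y) \<in># queue s"
    and done_le: "\<lbrakk>x \<in> Vmin N; node_done s x\<rbrakk> \<Longrightarrow> mark s x \<le> k"
    and max_le: "y \<in> Vmax N \<Longrightarrow> mark s y \<le> k"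
    and done_edges: "\<lbrakk>z \<in> Vmin N; node_done s z; y \<in> Succ N z\<rbrakk> \<Longrightarrow> edge_done s (z, y)"
    and cnt_eq: "y \<in> Vmax N \<Longrightarrow> cnt s y = card {z \<in> Pred N y. \<not> edge_done s (z, y)}"
    and cnt_0: "\<lbrakk>y \<in> Vmax N; cnt s y = 0\<rbrakk> \<Longrightarrow> (Node y, mark s y) \<in># queue s \<or>
          (\<forall>x \<in> Vmin N. mark s y < wt N y x \<longrightarrow> mark s x \<le> mark s y)"
    and mark_bounds: "v \<in> nodes N \<Longrightarrow> 0 \<le> mark s v \<and> mark s v \<le> 1"
    and mark_lim: "x \<in> Vmin N \<Longrightarrow> mark s x \<le> lim N x"
    and max_support: "y \<in> Vmax N \<Longrightarrow> \<exists>z \<in> Vmin N. mark s y \<le> wt N z y \<and> mark s y \<le> mark s z"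
    and min_above: "\<lbrakk>correct_marking N M; x \<in> Vmin N\<rbrakk> \<Longrightarrow> M x \<le> mark s x"
    and edge_above: "\<lbrakk>correct_marking N M; z \<in> Vmin N; y \<in> Vmax N; edge_done s (z, y)\<rbrakk> \<Longrightarrow>
          min (wt N z y) (M z) \<le> mark s y"
begin

lemma cnt_0_iff:
  assumes "y \<in> Vmax N"
  shows "cnt s y = 0 \<longleftrightarrow> (\<forall>z \<in> Vmin N. wt N z y > 0 \<longrightarrow> edge_done s (z, y))"
proof -
  have "cnt s y = card {z \<in> Pred N y. \<not> edge_done s (z, y)}" using assms by (rule cnt_eq)
  thus ?thesis using assms by (auto simp: Pred_max)
qed

text \<open>A min-node that supports \<open>M y\<close> lies on a settled edge, where
  \<open>edge_above\<close> applies, or its weight to \<open>y\<close> is not positive, and then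
  \<open>M y\<close> is at most 0.\<close>

lemma max_above:
  assumes M: "correct_marking N M" and y: "y \<in> Vmax N" and c: "cnt s y = 0"
  shows "M y \<le> mark s y"
proof -
  obtain z where z: "z \<in> Vmin N" "M y \<le> wt N z y" "M y \<le> M z"
    using M y unfolding correct_marking_iff by blast
  show ?thesis
  proof (cases "wt N z y > 0")
    case True
    hence "edge_done s (z, y)" using c cnt_0_iff y z(1) by blast
    from edge_above[OF M z(1) y this] z show ?thesis by linarith
  next
    case False
    thus ?thesis using z mark_bounds[of y] y by (auto simp: nodes_def)
  qed
qed

text \<open>Unsettled edges are still queued, so an empty queue forces all counters to 0. This
  leaves only the second alternative of \<open>cnt_0\<close>, which is the missing correctness
  condition, and makes \<open>max_above\<close> available at every max-node.\<close>

lemma greatest_if_empty: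
  assumes q: "queue s = {#}"
  shows "greatest_correct_marking N (mark s)"
proof -
  have e: "edge_done s (z, y)" if "z \<in> Vmin N" "y \<in> Vmax N" "wt N z y > 0" for z y
    using undone_edge[OF that] q by auto
  hence c: "cnt s y = 0" if "y \<in> Vmax N" for y using cnt_0_iff that by blast
  have "correct_marking N (mark s)"
    unfolding correct_marking_iff marking_def
    using mark_bounds mark_lim max_support cnt_0[OF _ c] q by auto
  thus ?thesis unfolding greatest_correct_marking_def
    using min_above max_above c by (auto simp: nodes_def)
qed

text \<open>The current mark of \<open>x\<close> is itself a key in the queue, so the smallest key
  cannot exceed it; \<open>queue_node\<close> gives the other inequality. Outdated entries with
  larger keys thus surface only after the node is done.\<close>

lemma undone_key:
  assumes "(Node x, k') \<in># queue s" "\<forall>(ob', k'') \<in># queue s. k' \<le> k''"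
    "x \<in> Vmin N" "\<not> node_done s x"
  shows "mark s x = k'"
  using queue_node[OF assms(1)] undone_node[OF assms(3,4)] assms Vmin_Vmax by fastforce

end

section \<open>The inner loops as simultaneous updates\<close>

definition settle_set :: "'v \<Rightarrow> 'v set \<Rightarrow> real \<Rightarrow> 'v alg_state \<Rightarrow> 'v alg_state" where
  "settle_set z Y k s = s\<lparr>
     mark := (\<lambda>y. if y \<in> Y \<and> \<not> edge_done s (z, y) then k else mark s y),
     edge_done := (\<lambda>e. edge_done s e \<or> fst e = z \<and> snd e \<in> Y),
     cnt := (\<lambda>y. if y \<in> Y \<and> \<not> edge_done s (z, y) then cnt s y - 1 else cnt s y),
     queue := queue s + image_mset (\<lambda>y. (Node y, k))
       (mset_set {y \<in> Y. \<not> edge_done s (z, y) \<and> cnt s y - 1 = 0})\<rparr>"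

definition lower_set :: "'v net \<Rightarrow> 'v \<Rightarrow> 'v set \<Rightarrow> 'v alg_state \<Rightarrow> 'v alg_state" where
  "lower_set N z X s = s\<lparr>
     mark := (\<lambda>x. if x \<in> X \<and> \<not> node_done s x \<and> wt N z x > mark s z then mark s z else mark s x),
     queue := queue s + image_mset (\<lambda>x. (Node x, mark s z))
       (mset_set {x \<in> X. \<not> node_done s x \<and> wt N z x > mark s z})\<rparr>"

lemma settle_set_empty [simp]: "settle_set z {} k s = s"
  by (simp add: settle_set_def)

text \<open>Settling \<open>y\<close> leaves the flags and counters of the other members of the
  batch alone, so members can be split off one at a time; this is also why the visiting order does
  not matter.\<close>

lemma settle_insert:
  assumes "finite Y" "y \<notin> Y"
  shows "settle_set z (insert y Y) k s = settle_set z Y k (settle z y k s)"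
proof -
  have *: "{u. (u = y \<or> u \<in> Y) \<and> P u} = (if P y then insert y {u \<in> Y. P u} else {u \<in> Y. P u})" for P
    by auto
  have **: "{u \<in> Y. \<not> edge_done (settle z y k s) (z, u) \<and> cnt (settle z y k s) u - 1 = 0} =
      {u \<in> Y. \<not> edge_done s (z, u) \<and> cnt s u - 1 = 0}"
    using assms by (auto simp: settle_def insert_node_def Let_def)
  show ?thesis
    by (rule alg_state.equality; unfold settle_set_def **)
      (use assms in \<open>auto simp: settle_def insert_node_def Let_def fun_eq_iff *\<close>)
qed

lemma settle_eq: "settle z y k s = settle_set z {y} k s"
  using settle_insert[of "{}" y z k s] by simp

text \<open>As \<open>z\<close> is not visited, its mark is constant during the loop, and rereading
  \<open>mark t z\<close> always gives the same key.\<close>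

lemma fold_settle:
  assumes "distinct vs" "z \<notin> set vs"
  shows "fold (\<lambda>y t. settle z y (mark t z) t) vs s = settle_set z (set vs) (mark s z) s"
  using assms
proof (induction vs arbitrary: s)
  case (Cons y vs)
  have "mark (settle z y (mark s z) s) z = mark s z"
    using Cons.prems by (simp add: settle_def insert_node_def Let_def)
  thus ?case using Cons by (simp add: settle_insert)
qed simp

lemma lower_set_empty [simp]: "lower_set N z {} s = s"
  by (simp add: lower_set_def)

lemma lower_insert:
  assumes "finite X" "x \<notin> X" "z \<noteq> x"
  shows "lower_set N z (insert x X) s = lower_set N z X (lower N z x s)"
proof -
  have *: "{u. (u = x \<or> u \<in> X) \<and> P u} = (if P x then insert x {u \<in> X. P u} else {u \<in> X. P u})" for P
    by auto
  have m: "mark (lower N z x s) z = mark s z" "node_done (lower N z x s) = node_done s"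
    using assms by (auto simp: lower_def insert_node_def)
  show ?thesis
    by (rule alg_state.equality; unfold lower_set_def m)
      (use assms in \<open>auto simp: lower_def insert_node_def fun_eq_iff *\<close>)
qed

lemma fold_lower:
  assumes "distinct vs" "z \<notin> set vs"
  shows "fold (lower N z) vs s = lower_set N z (set vs) s"
  using assms
proof (induction vs arbitrary: s)
  case (Cons x vs)
  thus ?case by (simp add: lower_insert)
qed simp

section \<open>Preservation of the invariant\<close>

context minimax begin

lemma init_inv: "alg_inv N (init_state N) 0"
proof -
  let ?s = "init_state N"
  have fe: "finite {(z, y). z \<in> Vmin N \<and> y \<in> Vmax N \<and> wt N z y > 0}"
    by (rule finite_subset[of _ "Vmin N \<times> Vmax N"]) auto
  show ?thesis
  proof unfold_locales
    fix M x assume "correct_marking N M" "x \<in> Vmin N"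
    thus "M x \<le> mark ?s x" by (simp add: init_state_def correct_marking_iff)
  next
    fix y assume y: "y \<in> Vmax N"
    \<comment> \<open>The initial mark of \<open>y\<close> is 0, so any min-node supports
      it.\<close>
    obtain z where "z \<in> Vmin N" using Vmin_ne by blast
    thus "\<exists>z \<in> Vmin N. mark ?s y \<le> wt N z y \<and> mark ?s y \<le> mark ?s z"
      using y wt_min_max lim_bounds Vmax_Vmin by (intro bexI[of _ z]) (auto simp: init_state_def)
  qed (use fe in \<open>auto simp: init_state_def lim_bounds nodes_def Vmax_Vmin Vmin_Vmax Pred_max
        wt_min_max card_eq_0_iff\<close>)
qed

text \<open>One statement serves all extractions other than max-nodes: an undone min-node
  (\<open>Y = Succ N z\<close>, and \<open>D\<close> adds \<open>z\<close>), an edge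
  (\<open>Y = {y}\<close>), and an outdated entry of a finished node (\<open>Y = {}\<close>). By
  \<open>key\<close>, the new mark \<open>k\<close> is the smaller of the edge weight and
  \<open>mark s z\<close>, which is the whole contribution of the edge. The conditions
  \<open>D\<close> and \<open>E\<close> ensure that whatever left the queue is done afterwards and
  that a newly finished node has all its edges settled.\<close>

lemma settle_inv:
  assumes inv: "alg_inv N s k\<^sub>0" and pop: "(ob, k) \<in># queue s"
    and min: "\<forall>(ob', k') \<in># queue s. k \<le> k'"
    and z: "z \<in> Vmin N" and Y: "Y \<subseteq> Succ N z"
    and key: "\<And>y. \<lbrakk>y \<in> Y; \<not> edge_done s (z, y)\<rbrakk> \<Longrightarrow>
      k \<le> wt N z y \<and> k \<le> mark s z \<and> (k = wt N z y \<or> k = mark s z)"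
    and D: "\<And>x. node_done s x \<Longrightarrow> D x"
      "\<And>x. \<lbrakk>x \<in> Vmin N; \<not> D x\<rbrakk> \<Longrightarrow> ob \<noteq> Node x"
      "\<And>x. \<lbrakk>x \<in> Vmin N; D x; \<not> node_done s x\<rbrakk> \<Longrightarrow> x = z \<and> Y = Succ N z \<and> mark s z = k"
    and E: "\<And>u y. \<lbrakk>ob = Edge u y; \<not> edge_done s (u, y)\<rbrakk> \<Longrightarrow> u = z \<and> y \<in> Y"
    and mx: "\<And>y. y \<in> Vmax N \<Longrightarrow> ob \<noteq> Node y"
  shows "alg_inv N ((settle_set z Y k (s\<lparr>queue := queue s - {#(ob, k)#}\<rparr>))\<lparr>node_done := D\<rparr>) k"
    (is "alg_inv N ?s k")
proof -
  interpret alg_inv N s k\<^sub>0 by (rule inv)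
  have k0: "k\<^sub>0 \<le> k" using k_le pop by blast
  have YV: "y \<in> Vmax N" "wt N z y > 0" "y \<notin> Vmin N" if "y \<in> Y" for y
    using that Y z Succ_min Vmax_Vmin by auto
  have fY: "finite Y" using Y finite_Succ finite_subset by blast
  have zY: "z \<notin> Y" using YV z by blast
  let ?A = "{y \<in> Y. \<not> edge_done s (z, y) \<and> cnt s y - 1 = 0}"
  have fA: "finite ?A" using fY by auto
  have q: "queue ?s = queue s - {#(ob, k)#} + image_mset (\<lambda>y. (Node y, k)) (mset_set ?A)"
    and m: "mark ?s = (\<lambda>y. if y \<in> Y \<and> \<not> edge_done s (z, y) then k else mark s y)"
    and e: "edge_done ?s = (\<lambda>e. edge_done s e \<or> fst e = z \<and> snd e \<in> Y)"
    and c: "cnt ?s = (\<lambda>y. if y \<in> Y \<and> \<not> edge_done s (z, y) then cnt s y - 1 else cnt s y)"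
    and d: "node_done ?s = D"
    by (simp_all add: settle_set_def cong: if_cong)
  have q_in: "o' = ob \<and> k' = k \<or> (o', k') \<in># queue ?s" if "(o', k') \<in># queue s" for o' k'
    using that by (auto simp: q in_diff_count)
  have q_out: "(o', k') \<in># queue s \<or> k' = k \<and> (\<exists>y \<in> ?A. o' = Node y)" if "(o', k') \<in># queue ?s" for o' k'
    using that fA unfolding q by (auto dest: in_diffD)
  have mmin: "mark ?s x = mark s x" if "x \<in> Vmin N" for x using that YV by (auto simp: m)
  \<comment> \<open>Overwriting never lowers a max-node, because its old mark is at most
    \<open>k\<^sub>0\<close> and keys do not decrease; contributions settled earlier stay
    covered.\<close>
  have mmax: "mark s y \<le> mark ?s y" "mark ?s y \<le> k" if "y \<in> Vmax N" for y
    using max_le[OF that] k0 by (auto simp: m)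
  \<comment> \<open>Hence a max-node that is already queued, with counter 0, keeps its mark and its
    counter.\<close>
  have cpos: "cnt s y > 0" if "y \<in> Y" "\<not> edge_done s (z, y)" for y
    using that YV cnt_0_iff z by blast
  show ?thesis
  proof unfold_locales
    show "0 \<le> k" using k0 k_nonneg by simp
  next
    fix o' k' assume "(o', k') \<in># queue ?s"
    thus "k \<le> k'" using q_out min by fastforce
  next
    fix v k' assume a: "(Node v, k') \<in># queue ?s"
    show "v \<in> Vmin N \<and> (\<not> node_done ?s v \<longrightarrow> mark ?s v \<le> k') \<or>
          v \<in> Vmax N \<and> cnt ?s v = 0 \<and> mark ?s v = k'"
    proof (cases "(Node v, k') \<in># queue s")
      case True
      from queue_node[OF this] show ?thesis
      proof
        assume "v \<in> Vmin N \<and> (\<not> node_done s v \<longrightarrow> mark s v \<le> k')"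
        thus ?thesis using mmin D(1) by (auto simp: d)
      next
        assume "v \<in> Vmax N \<and> cnt s v = 0 \<and> mark s v = k'"
        thus ?thesis using cpos[of v] by (fastforce simp: m c)
      qed
    next
      case False
      thus ?thesis using q_out[OF a] YV by (auto simp: m c)
    qed
  next
    fix u y k' assume "(Edge u y, k') \<in># queue ?s"
    thus "u \<in> Vmin N \<and> y \<in> Vmax N \<and> 0 < wt N u y \<and> k' = wt N u y"
      using q_out queue_edge by blast
  next
    fix x assume "x \<in> Vmin N" "\<not> node_done ?s x"
    thus "(Node x, mark ?s x) \<in># queue ?s"
      using undone_node[of x] q_in D mmin by (metis d)
  next
    fix u y assume "u \<in> Vmin N" "y \<in> Vmax N" "0 < wt N u y" "\<not> edge_done ?s (u, y)"
    thus "(Edge u y, wt N u y) \<in># queue ?s"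
      using undone_edge[of u y] q_in E by (fastforce simp: e)
  next
    fix x assume "x \<in> Vmin N" "node_done ?s x"
    thus "mark ?s x \<le> k" using done_le[of x] k0 D(3)[of x] mmin by (fastforce simp: d)
  next
    fix y assume "y \<in> Vmax N"
    thus "mark ?s y \<le> k" by (rule mmax)
  next
    fix u y assume "u \<in> Vmin N" "node_done ?s u" "y \<in> Succ N u"
    thus "edge_done ?s (u, y)" using done_edges D(3)[of u] by (auto simp: d e)
  next
    fix y assume y: "y \<in> Vmax N"
    have eq: "{u \<in> Pred N y. \<not> edge_done ?s (u, y)} =
      (if y \<in> Y \<and> \<not> edge_done s (z, y) then {u \<in> Pred N y. \<not> edge_done s (u, y)} - {z}
       else {u \<in> Pred N y. \<not> edge_done s (u, y)})" by (auto simp: e)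
    show "cnt ?s y = card {u \<in> Pred N y. \<not> edge_done ?s (u, y)}"
      unfolding eq using cnt_eq[OF y] y z YV by (auto simp: c Pred_max card_Diff_singleton)
  next
    fix y assume y: "y \<in> Vmax N" and c0: "cnt ?s y = 0"
    show "(Node y, mark ?s y) \<in># queue ?s \<or>
          (\<forall>x \<in> Vmin N. mark ?s y < wt N y x \<longrightarrow> mark ?s x \<le> mark ?s y)"
    proof (cases "y \<in> Y \<and> \<not> edge_done s (z, y)")
      case True
      hence "y \<in> ?A" using c0 by (auto simp: c)
      thus ?thesis using fA True by (auto simp: q m)
    next
      case False
      hence "cnt s y = 0" and my: "mark ?s y = mark s y" using c0 by (auto simp: c m)
      from cnt_0[OF y this(1)] show ?thesis
        using q_in[of "Node y"] mx[OF y] mmin unfolding my by auto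
    qed
  next
    fix v assume v: "v \<in> nodes N"
    have "k \<le> 1" if "y \<in> Y" "\<not> edge_done s (z, y)" for y
      using key[OF that] wt_min_max[OF z YV(1)[OF that(1)]] by simp
    thus "0 \<le> mark ?s v \<and> mark ?s v \<le> 1" using mark_bounds[OF v] k0 k_nonneg by (auto simp: m)
  next
    fix x assume "x \<in> Vmin N"
    thus "mark ?s x \<le> lim N x" using mmin mark_lim by simp
  next
    fix y assume y: "y \<in> Vmax N"
    show "\<exists>u \<in> Vmin N. mark ?s y \<le> wt N u y \<and> mark ?s y \<le> mark ?s u"
    proof (cases "y \<in> Y \<and> \<not> edge_done s (z, y)")
      case True
      thus ?thesis using key[of y] z zY by (intro bexI[of _ z]) (auto simp: m)
    next
      case False
      hence my: "mark ?s y = mark s y" by (auto simp: m)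
      show ?thesis unfolding my using max_support[OF y] mmin by auto
    qed
  next
    fix M x assume "correct_marking N M" "x \<in> Vmin N"
    thus "M x \<le> mark ?s x" using min_above mmin by simp
  next
    fix M u y assume M: "correct_marking N M" and u: "u \<in> Vmin N" and y: "y \<in> Vmax N"
      and ed: "edge_done ?s (u, y)"
    show "min (wt N u y) (M u) \<le> mark ?s y"
    proof (cases "edge_done s (u, y)")
      case True
      thus ?thesis using edge_above[OF M u y] mmax[OF y] by simp
    next
      case False
      hence "u = z" "y \<in> Y" using ed by (auto simp: e)
      \<comment> \<open>\<open>k\<close> is the smaller of the weight and \<open>mark s z\<close>,
        and \<open>M z\<close> is at most \<open>mark s z\<close>.\<close>
      thus ?thesis using key[of y] False min_above[OF M z] by (auto simp: m)
    qed
  qed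
qed

text \<open>The counter of \<open>z\<close> is 0, so \<open>max_above\<close> gives
  \<open>M z \<le> k\<close> for every correct \<open>M\<close>. If the edge to \<open>x\<close>
  weighs more than \<open>k\<close>, correctness then forces \<open>M x \<le> M z\<close>, so
  lowering \<open>x\<close> to \<open>k\<close> cuts off no correct marking.\<close>

lemma lower_inv:
  assumes inv: "alg_inv N s k\<^sub>0" and pop: "(Node z, k) \<in># queue s"
    and min: "\<forall>(ob', k') \<in># queue s. k \<le> k'" and z: "z \<in> Vmax N"
  shows "alg_inv N (lower_set N z (Succ N z) (s\<lparr>queue := queue s - {#(Node z, k)#}\<rparr>)) k"
    (is "alg_inv N ?s k")
proof -
  interpret alg_inv N s k\<^sub>0 by (rule inv)
  have k0: "k\<^sub>0 \<le> k" using k_le pop by blast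
  have kz: "mark s z = k" "cnt s z = 0" using queue_node[OF pop] z Vmax_Vmin by auto
  let ?A = "{x \<in> Succ N z. \<not> node_done s x \<and> wt N z x > mark s z}"
  have A: "x \<in> Vmin N" "x \<notin> Vmax N" if "x \<in> ?A" for x using that z Succ_max Vmin_Vmax by auto
  have fA: "finite ?A" by auto
  have q: "queue ?s = queue s - {#(Node z, k)#} + image_mset (\<lambda>x. (Node x, k)) (mset_set ?A)"
    and m: "mark ?s = (\<lambda>x. if x \<in> ?A then k else mark s x)"
    and r [simp]: "node_done ?s = node_done s" "edge_done ?s = edge_done s" "cnt ?s = cnt s"
    by (simp_all add: lower_set_def kz cong: if_cong)
  have q_in: "o' = Node z \<and> k' = k \<or> (o', k') \<in># queue ?s" if "(o', k') \<in># queue s" for o' k'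
    using that by (auto simp: q in_diff_count)
  have q_out: "(o', k') \<in># queue s \<or> k' = k \<and> (\<exists>x \<in> ?A. o' = Node x)" if "(o', k') \<in># queue ?s" for o' k'
    using that fA unfolding q by (auto dest: in_diffD)
  have ge: "k \<le> mark s x" if "x \<in> ?A" for x
    using undone_node[of x] A[OF that] that min by auto
  have le: "mark ?s v \<le> mark s v" for v using ge by (auto simp: m)
  have mmax: "mark ?s y = mark s y" if "y \<in> Vmax N" for y using that A by (auto simp: m)
  show ?thesis
  proof unfold_locales
    show "0 \<le> k" using k0 k_nonneg by simp
  next
    fix o' k' assume "(o', k') \<in># queue ?s"
    thus "k \<le> k'" using q_out min by fastforce
  next
    fix v k' assume a: "(Node v, k') \<in># queue ?s"
    from q_out[OF this] show "v \<in> Vmin N \<and> (\<not> node_done ?s v \<longrightarrow> mark ?s v \<le> k') \<or>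
          v \<in> Vmax N \<and> cnt ?s v = 0 \<and> mark ?s v = k'"
    proof
      assume "(Node v, k') \<in># queue s"
      from queue_node[OF this] show ?thesis using le[of v] mmax by auto
    next
      assume "k' = k \<and> (\<exists>x \<in> ?A. Node v = Node x)"
      thus ?thesis using A by (auto simp: m)
    qed
  next
    fix u y k' assume "(Edge u y, k') \<in># queue ?s"
    thus "u \<in> Vmin N \<and> y \<in> Vmax N \<and> 0 < wt N u y \<and> k' = wt N u y"
      using q_out queue_edge by blast
  next
    fix x assume x: "x \<in> Vmin N" "\<not> node_done ?s x"
    show "(Node x, mark ?s x) \<in># queue ?s"
    proof (cases "x \<in> ?A")
      case True
      thus ?thesis using fA by (auto simp: q m)
    next
      case False
      hence "mark ?s x = mark s x" unfolding m by meson
      thus ?thesis using undone_node[of x] x q_in z Vmax_Vmin by fastforce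
    qed
  next
    fix u y assume "u \<in> Vmin N" "y \<in> Vmax N" "0 < wt N u y" "\<not> edge_done ?s (u, y)"
    thus "(Edge u y, wt N u y) \<in># queue ?s" using undone_edge[of u y] q_in by fastforce
  next
    fix x assume "x \<in> Vmin N" "node_done ?s x"
    thus "mark ?s x \<le> k" using done_le[of x] k0 le[of x] by simp
  next
    fix y assume "y \<in> Vmax N"
    thus "mark ?s y \<le> k" using max_le[of y] k0 mmax by simp
  next
    fix u y assume "u \<in> Vmin N" "node_done ?s u" "y \<in> Succ N u"
    thus "edge_done ?s (u, y)" using done_edges by simp
  next
    fix y assume "y \<in> Vmax N"
    thus "cnt ?s y = card {u \<in> Pred N y. \<not> edge_done ?s (u, y)}" using cnt_eq by simp
  next
    fix y assume y: "y \<in> Vmax N" and c0: "cnt ?s y = 0"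
    show "(Node y, mark ?s y) \<in># queue ?s \<or>
          (\<forall>x \<in> Vmin N. mark ?s y < wt N y x \<longrightarrow> mark ?s x \<le> mark ?s y)"
    proof (cases "y = z")
      case True
      have "mark ?s x \<le> k" if "x \<in> Vmin N" "k < wt N z x" for x
      proof (cases "node_done s x")
        \<comment> \<open>The loop skips finished nodes, but their marks are at most the old key and
          so satisfy the condition already.\<close>
        case True thus ?thesis using done_le[of x] that k0 le[of x] by simp
      next
        case False
        hence "x \<in> ?A" using that kz k0 k_nonneg Succ_max[OF z] by simp
        thus ?thesis unfolding m by simp
      qed
      thus ?thesis using True kz mmax z by auto
    next
      case False
      have my: "mark ?s y = mark s y" using mmax y by simp
      have "cnt s y = 0" using c0 by simp
      from cnt_0[OF y this] show ?thesis
      proof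
        assume "(Node y, mark s y) \<in># queue s"
        thus ?thesis using q_in[of "Node y"] False my by auto
      next
        assume "\<forall>x \<in> Vmin N. mark s y < wt N y x \<longrightarrow> mark s x \<le> mark s y"
        thus ?thesis using le order_trans unfolding my by blast
      qed
    qed
  next
    fix v assume v: "v \<in> nodes N"
    have "k \<le> 1" using mark_bounds[of z] z kz by (auto simp: nodes_def)
    thus "0 \<le> mark ?s v \<and> mark ?s v \<le> 1" using mark_bounds[OF v] k0 k_nonneg by (auto simp: m)
  next
    fix x assume "x \<in> Vmin N"
    thus "mark ?s x \<le> lim N x" using le[of x] mark_lim[of x] by simp
  next
    fix y assume y: "y \<in> Vmax N"
    obtain u where u: "u \<in> Vmin N" "mark s y \<le> wt N u y" "mark s y \<le> mark s u"
      using max_support[OF y] by blast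
    \<comment> \<open>Lowering stops at \<open>k\<close>, which no max-node mark exceeds, so a
      supporting node still supports.\<close>
    have "mark s y \<le> mark ?s u" using u max_le[OF y] k0 by (auto simp: m)
    thus "\<exists>u \<in> Vmin N. mark ?s y \<le> wt N u y \<and> mark ?s y \<le> mark ?s u"
      using u mmax[OF y] by auto
  next
    fix M x assume M: "correct_marking N M" and x: "x \<in> Vmin N"
    show "M x \<le> mark ?s x"
    proof (cases "x \<in> ?A")
      case True
      have "M z \<le> k" using max_above[OF M z kz(2)] kz by simp
      moreover have "M z < wt N z x" using True kz \<open>M z \<le> k\<close> by auto
      ultimately have "M x \<le> k" using M x z unfolding correct_marking_iff by force
      thus ?thesis using True by (simp add: m)
    next
      case False
      hence "mark ?s x = mark s x" unfolding m by meson
      thus ?thesis using min_above[OF M x] by simp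
    qed
  next
    fix M u y assume "correct_marking N M" "u \<in> Vmin N" "y \<in> Vmax N" "edge_done ?s (u, y)"
    thus "min (wt N u y) (M u) \<le> mark ?s y" using edge_above mmax by simp
  qed
qed

section \<open>Change of the potential in one iteration\<close>

lemma potential_pop:
  assumes "(ob, k) \<in># queue s"
  shows "potential s = potential (s\<lparr>queue := queue s - {#(ob, k)#}\<rparr>) + weight ob"
proof -
  have "queue s = add_mset (ob, k) (queue s - {#(ob, k)#})" using assms by simp
  hence "(\<Sum>(ob, _) \<in># queue s. weight ob) =
      weight ob + (\<Sum>(ob, _) \<in># queue s - {#(ob, k)#}. weight ob)"
    by (metis (no_types, lifting) case_prod_conv image_mset_add_mset sum_mset.add_mset)
  thus ?thesis by (simp add: potential_def)
qed

text \<open>The pushed nodes move from the sum over pending max-nodes to the queue with the same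
  weight. Positive counters are what puts them into the former sum: a counter 0 would also stay 0
  under truncated subtraction.\<close>

lemma potential_settle_set:
  assumes "Y \<subseteq> Vmax N" "\<And>y. \<lbrakk>y \<in> Y; \<not> edge_done s (z, y)\<rbrakk> \<Longrightarrow> cnt s y > 0"
  shows "potential (settle_set z Y k s) = potential s"
proof -
  let ?A = "{y \<in> Y. \<not> edge_done s (z, y) \<and> cnt s y - 1 = 0}"
  let ?C = "{y \<in> Vmax N. cnt s y > 0}"
  have "{y \<in> Vmax N. cnt (settle_set z Y k s) y > 0} = ?C - ?A"
    using assms by (auto simp: settle_set_def)
  moreover have "?A \<subseteq> ?C" using assms by auto
  hence "(\<Sum>y \<in> ?C. weight (Node y)) = (\<Sum>y \<in> ?C - ?A. weight (Node y)) + (\<Sum>y \<in> ?A. weight (Node y))"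
    by (intro sum.subset_diff) auto
  ultimately show ?thesis
    by (simp add: potential_def settle_set_def sum_unfold_sum_mset image_mset.compositionality o_def)
qed

lemma potential_node_done:
  assumes "z \<in> Vmin N" "\<not> node_done s z"
  shows "potential s = potential (s\<lparr>node_done := (node_done s)(z := True)\<rparr>) + card (Succ N z)"
proof -
  have eq: "{x \<in> Vmin N. \<not> ((node_done s)(z := True)) x} = {x \<in> Vmin N. \<not> node_done s x} - {z}"
    by auto
  have "(\<Sum>x \<in> {x \<in> Vmin N. \<not> node_done s x}. card (Succ N x)) = card (Succ N z) +
      (\<Sum>x \<in> {x \<in> Vmin N. \<not> ((node_done s)(z := True)) x}. card (Succ N x))"
    unfolding eq using assms by (intro sum.remove) auto
  thus ?thesis by (simp add: potential_def del: fun_upd_apply)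
qed

lemma potential_lower_set:
  assumes "z \<in> Vmax N"
  shows "potential (lower_set N z (Succ N z) s) \<le> potential s + card (Succ N z)"
proof -
  let ?A = "{x \<in> Succ N z. \<not> node_done s x \<and> wt N z x > mark s z}"
  have "weight (Node x) = 1" if "x \<in> ?A" for x
    using that assms Succ_max Vmin_Vmax by (auto simp: weight_def)
  hence "(\<Sum>x \<in> ?A. weight (Node x)) = card ?A" by simp
  moreover have "card ?A \<le> card (Succ N z)" by (rule card_mono) auto
  ultimately show ?thesis
    by (simp add: potential_def lower_set_def sum_unfold_sum_mset image_mset.compositionality o_def)
qed

text \<open>The last conjunct ties the length of the scan to the potential. For a max-node with
  \<open>d\<close> successors the extraction releases \<open>1 + 2 * d\<close>, of which at most
  \<open>d\<close> goes into new entries. For an undone min-node it releases 1, and finishing the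
  node releases \<open>d\<close>.\<close>

lemma process_node_inv:
  assumes inv: "alg_inv N s k\<^sub>0" and pop: "(Node z, k) \<in># queue s"
    and min: "\<forall>(ob', k') \<in># queue s. k \<le> k'"
    and vs: "distinct vs" "set vs = Succ N z"
    and s': "s' = process_node N z vs (s\<lparr>queue := queue s - {#(Node z, k)#}\<rparr>)"
  shows "alg_inv N s' k \<and> potential s' + 1 \<le> potential s \<and>
    (z \<in> Vmax N \<or> \<not> node_done s z \<longrightarrow> potential s' + 1 + card (Succ N z) \<le> potential s)"
proof -
  interpret alg_inv N s k\<^sub>0 by (rule inv)
  let ?s = "s\<lparr>queue := queue s - {#(Node z, k)#}\<rparr>"
  note pot = potential_pop[OF pop]
  show ?thesis
  proof (cases "z \<in> Vmax N")
    case True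
    hence "z \<notin> set vs" using vs Succ_max Vmax_Vmin by auto
    hence eq: "s' = lower_set N z (Succ N z) ?s"
      using True vs by (simp add: s' process_node_def fold_lower)
    show ?thesis using lower_inv[OF inv pop min True] potential_lower_set[OF True, of ?s] pot True
      by (simp add: eq weight_def)
  next
    case nmax: False
    hence z: "z \<in> Vmin N" using queue_node[OF pop] by blast
    show ?thesis
    proof (cases "node_done s z")
      case True
      hence eq: "s' = (settle_set z {} k ?s)\<lparr>node_done := node_done s\<rparr>"
        using nmax by (simp add: s' process_node_def)
      have "alg_inv N s' k" unfolding eq
        by (rule settle_inv[OF inv pop min z]) (use nmax z True in auto)
      thus ?thesis using eq pot True nmax by (simp add: weight_def)
    next
      case False
      have kz: "mark s z = k" using undone_key[OF pop min z False] .
      have zn: "z \<notin> set vs" using vs Succ_min z Vmin_Vmax by auto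
      have eq: "s' = (settle_set z (Succ N z) k ?s)\<lparr>node_done := (node_done s)(z := True)\<rparr>"
        using nmax False vs kz zn
        by (simp add: s' process_node_def fold_settle) (simp add: settle_set_def)
      \<comment> \<open>An unsettled edge is still queued under its weight, so the smallest key
        \<open>k\<close> is at most that weight.\<close>
      have *: "y \<in> Vmax N \<and> cnt s y > 0 \<and> k \<le> wt N z y" if "y \<in> Succ N z" "\<not> edge_done s (z, y)" for y
        using that z cnt_0_iff undone_edge[of z y] min by (auto simp: Succ_min)
      have "alg_inv N s' k" unfolding eq
        by (rule settle_inv[OF inv pop min z]) (use nmax * kz in \<open>auto split: if_splits\<close>)
      moreover have "potential (settle_set z (Succ N z) k ?s) = potential ?s"
      proof (rule potential_settle_set)
        show "Succ N z \<subseteq> Vmax N" using z by (auto simp: Succ_min)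
      qed (use * in auto)
      moreover have "potential (settle_set z (Succ N z) k ?s) = potential s' + card (Succ N z)"
        using potential_node_done[OF z, of "settle_set z (Succ N z) k ?s"] False
        by (simp add: eq settle_set_def)
      ultimately show ?thesis using pot nmax by (simp add: weight_def)
    qed
  qed
qed

text \<open>If the edge is unsettled then \<open>z\<close> is not done, by
  \<open>done_edges\<close>, and so is queued under its current mark. That mark is therefore at
  least \<open>k = wt N z y\<close>, and the weight is the smaller of the two.\<close>

lemma settle_edge_inv:
  assumes inv: "alg_inv N s k\<^sub>0" and pop: "(Edge z y, k) \<in># queue s"
    and min: "\<forall>(ob', k') \<in># queue s. k \<le> k'"
    and s': "s' = settle z y (wt N z y) (s\<lparr>queue := queue s - {#(Edge z y, k)#}\<rparr>)"
  shows "alg_inv N s' k \<and> potential s' + 1 \<le> potential s"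
proof -
  interpret alg_inv N s k\<^sub>0 by (rule inv)
  let ?s = "s\<lparr>queue := queue s - {#(Edge z y, k)#}\<rparr>"
  have zy: "z \<in> Vmin N" "y \<in> Vmax N" "0 < wt N z y" "k = wt N z y" using queue_edge[OF pop] by auto
  have nd: "\<not> node_done s z \<and> k \<le> mark s z \<and> cnt s y > 0" if "\<not> edge_done s (z, y)"
    using that zy done_edges[of z y] undone_node[of z] min cnt_0_iff[of y] by (auto simp: Succ_min)
  have eq: "s' = (settle_set z {y} k ?s)\<lparr>node_done := node_done s\<rparr>"
    using zy by (simp add: s' settle_eq) (simp add: settle_set_def)
  have eq2: "s' = settle_set z {y} k ?s"
    using zy by (simp add: s' settle_eq)
  have "alg_inv N s' k" unfolding eq
  proof (rule settle_inv[OF inv pop min zy(1)])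
    show "{y} \<subseteq> Succ N z" using zy by (auto simp: Succ_min)
  qed (use zy nd in auto)
  moreover have "potential s' = potential ?s" unfolding eq2
    by (rule potential_settle_set) (use zy nd in auto)
  ultimately show ?thesis using potential_pop[OF pop] by (simp add: weight_def)
qed

section \<open>Termination and correctness of every run\<close>

lemma alg_step_inv:
  assumes "alg_step N s s'" "alg_inv N s k"
  shows "\<exists>k'. alg_inv N s' k' \<and> potential s' < potential s"
  using assms(1)
proof cases
  case (node z s1 vs)
  then obtain k' where "(Node z, k') \<in># queue s" "\<forall>(ob', k'') \<in># queue s. k' \<le> k''"
    "s1 = s\<lparr>queue := queue s - {#(Node z, k')#}\<rparr>" unfolding pop_min_def by blast
  from process_node_inv[OF assms(2) this(1,2) node(3,4) refl] this(3) node(1) show ?thesis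
    by auto
next
  case (edge z y s1)
  then obtain k' where "(Edge z y, k') \<in># queue s" "\<forall>(ob', k'') \<in># queue s. k' \<le> k''"
    "s1 = s\<lparr>queue := queue s - {#(Edge z y, k')#}\<rparr>" unfolding pop_min_def by blast
  from settle_edge_inv[OF assms(2) this(1,2) refl] this(3) edge(1) show ?thesis
    by auto
qed

lemma steps_inv:
  assumes "(alg_step N)\<^sup>*\<^sup>* (init_state N) s"
  shows "\<exists>k. alg_inv N s k"
  using assms by induction (use init_inv alg_step_inv in blast)+

text \<open>Ignoring an object also counts as an iteration, so any entry of smallest key permits a
  step, and a maximal run can stop only at an empty queue.\<close>

lemma alg_step_exists:
  assumes "queue s \<noteq> {#}"
  shows "\<exists>s'. alg_step N s s'"
proof -
  let ?K = "snd ` set_mset (queue s)"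
  have "Min ?K \<in> ?K" using assms by (intro Min_in) auto
  then obtain ob where ob: "(ob, Min ?K) \<in># queue s" by auto
  have "Min ?K \<le> k'" if "(o', k') \<in># queue s" for o' k'
    using that by (intro Min_le) force+
  hence pop: "pop_min s ob (s\<lparr>queue := queue s - {#(ob, Min ?K)#}\<rparr>)"
    unfolding pop_min_def using ob by blast
  show ?thesis
  proof (cases ob)
    case (Node z)
    obtain vs where "distinct vs" "set vs = Succ N z"
      using finite_distinct_list[OF finite_Succ] by blast
    hence "alg_step N s (process_node N z vs (s\<lparr>queue := queue s - {#(ob, Min ?K)#}\<rparr>))"
      using pop Node by (intro alg_step.node) auto
    thus ?thesis ..
  next
    case (Edge z y)
    hence "alg_step N s (settle z y (wt N z y) (s\<lparr>queue := queue s - {#(ob, Min ?K)#}\<rparr>))"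
      using pop by (intro alg_step.edge) auto
    thus ?thesis ..
  qed
qed

lemma returns_greatest: "alg_returns_greatest N"
  unfolding alg_returns_greatest_def
proof (intro conjI allI impI)
  show "alg_terminates N" unfolding alg_terminates_def
  proof
    assume "\<exists>s. s 0 = init_state N \<and> (\<forall>i. alg_step N (s i) (s (Suc i)))"
    then obtain s where s: "s 0 = init_state N" "\<And>i. alg_step N (s i) (s (Suc i))" by blast
    have "\<exists>k. alg_inv N (s i) k" for i
    proof (induction i)
      case 0
      show ?case using init_inv s(1) by auto
    next
      case (Suc i)
      thus ?case using alg_step_inv[OF s(2)] by blast
    qed
    hence "potential (s (Suc i)) < potential (s i)" for i using s(2) alg_step_inv by blast
    hence dec: "potential (s (Suc i)) + 1 \<le> potential (s i)" for i by (metis Suc_eq_plus1 Suc_leI)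
    have "potential (s i) + i \<le> potential (s 0)" for i
    proof (induction i)
      case (Suc i)
      thus ?case using dec[of i] by simp
    qed simp
    from this[of "Suc (potential (s 0))"] show False by simp
  qed
next
  fix s assume a: "(alg_step N)\<^sup>*\<^sup>* (init_state N) s \<and> (\<nexists>s'. alg_step N s s')"
  then show q: "queue s = {#}" using alg_step_exists by blast
  from a steps_inv obtain k where "alg_inv N s k" by blast
  thus "greatest_correct_marking N (mark s)" by (rule alg_inv.greatest_if_empty) (rule q)
qed

end

section \<open>Timed reachability for the machine\<close>

text \<open>\<open>T\<close> is only an upper bound, so that branches of different length can share
  one estimate.\<close>

definition reach :: "nat \<Rightarrow> prog \<times> mem \<Rightarrow> prog \<times> mem \<Rightarrow> bool" where
  "reach T c c' \<longleftrightarrow> (\<exists>t \<le> T. (small_step ^^ t) c = c')"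

lemma reach_refl: "reach T c c"
  unfolding reach_def by (intro exI[of _ 0]) simp

lemma reach_trans:
  assumes "reach T\<^sub>1 c c'" "reach T\<^sub>2 c' c''"
  shows "reach (T\<^sub>1 + T\<^sub>2) c c''"
proof -
  obtain t\<^sub>1 t\<^sub>2 where "t\<^sub>1 \<le> T\<^sub>1" "(small_step ^^ t\<^sub>1) c = c'" "t\<^sub>2 \<le> T\<^sub>2" "(small_step ^^ t\<^sub>2) c' = c''"
    using assms unfolding reach_def by blast
  thus ?thesis unfolding reach_def
    by (intro exI[of _ "t\<^sub>1 + t\<^sub>2"]) (simp add: funpow_add add.commute[of t\<^sub>1 t\<^sub>2])
qed

lemma reach_mono: "reach T c c' \<Longrightarrow> T \<le> T' \<Longrightarrow> reach T' c c'"
  unfolding reach_def using le_trans by blast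

lemma reach_step: "small_step c = c' \<Longrightarrow> reach 1 c c'"
  unfolding reach_def by (intro exI[of _ 1]) simp

lemma steps_Skip: "(small_step ^^ t) (Skip, \<sigma>) = (Skip, \<sigma>)"
  by (induction t) auto

text \<open>The count may shrink: \<open>Skip\<close> idles on its own, while
  \<open>Seq Skip q\<close> would move on to \<open>q\<close>, so idle steps must not be
  replayed.\<close>

lemma steps_Seq:
  "(small_step ^^ t) (p, \<sigma>) = (Skip, \<sigma>') \<Longrightarrow>
    \<exists>t' \<le> t. (small_step ^^ t') (Seq p q, \<sigma>) = (Seq Skip q, \<sigma>')"
proof (induction t arbitrary: p \<sigma>)
  case (Suc t)
  show ?case
  proof (cases "p = Skip")
    case True
    thus ?thesis using Suc.prems steps_Skip[of "Suc t" \<sigma>] by (intro exI[of _ 0]) auto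
  next
    case False
    obtain p1 \<sigma>1 where s: "small_step (p, \<sigma>) = (p1, \<sigma>1)" by fastforce
    hence "(small_step ^^ t) (p1, \<sigma>1) = (Skip, \<sigma>')" using Suc.prems by (simp add: funpow_Suc_right del: funpow.simps)
    from Suc.IH[OF this] obtain t' where "t' \<le> t"
      "(small_step ^^ t') (Seq p1 q, \<sigma>1) = (Seq Skip q, \<sigma>')" by blast
    thus ?thesis using False s
      by (intro exI[of _ "Suc t'"]) (simp add: funpow_Suc_right del: funpow.simps)
  qed
qed auto

lemma reach_Seq:
  assumes "reach T (p, \<sigma>) (Skip, \<sigma>')"
  shows "reach (T + 1) (Seq p q, \<sigma>) (q, \<sigma>')"
proof -
  have "reach T (Seq p q, \<sigma>) (Seq Skip q, \<sigma>')"
    using assms steps_Seq le_trans unfolding reach_def by blast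
  thus ?thesis by (rule reach_trans) (rule reach_step, simp)
qed

lemma reach_Seq2:
  assumes "reach T\<^sub>1 (p, \<sigma>) (Skip, \<sigma>\<^sub>1)" "reach T\<^sub>2 (q, \<sigma>\<^sub>1) c"
  shows "reach (T\<^sub>1 + T\<^sub>2 + 1) (Seq p q, \<sigma>) c"
  using reach_trans[OF reach_Seq[OF assms(1)] assms(2)] by (simp add: ac_simps)

lemma reach_Cond:
  assumes "reach T (if holds b \<sigma> then p else q, \<sigma>) c"
  shows "reach (T + 1) (Cond b p q, \<sigma>) c"
  using reach_trans[OF reach_step assms, of "(Cond b p q, \<sigma>)"] by (simp add: add.commute)

lemma reach_Cond_True: "holds b \<sigma> \<Longrightarrow> reach T (p, \<sigma>) c \<Longrightarrow> reach (T + 1) (Cond b p q, \<sigma>) c"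
  and reach_Cond_False: "\<not> holds b \<sigma> \<Longrightarrow> reach T (q, \<sigma>) c \<Longrightarrow> reach (T + 1) (Cond b p q, \<sigma>) c"
  by (rule reach_Cond; simp)+

text \<open>A positive number of steps is exhibited because the times at which states are
  represented must increase strictly. The two extra steps unfold the loop and drop the finished
  \<open>Skip\<close>.\<close>

lemma reach_While:
  assumes "holds b \<sigma>" "reach T (p, \<sigma>) (Skip, \<sigma>')"
  shows "\<exists>t. 0 < t \<and> t \<le> T + 2 \<and> (small_step ^^ t) (While b p, \<sigma>) = (While b p, \<sigma>')"
proof -
  obtain t where "t \<le> T + 1" "(small_step ^^ t) (Seq p (While b p), \<sigma>) = (While b p, \<sigma>')"
    using reach_Seq[OF assms(2)] unfolding reach_def by blast
  thus ?thesis using assms(1)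
    by (intro exI[of _ "Suc t"]) (simp add: funpow_Suc_right del: funpow.simps)
qed

lemma reach_While_iter:
  assumes "holds b \<sigma>" "reach T (p, \<sigma>) (Skip, \<sigma>')"
  shows "reach (T + 2) (While b p, \<sigma>) (While b p, \<sigma>')"
  using reach_While[OF assms] unfolding reach_def by blast

lemma reach_While_exit: "\<not> holds b \<sigma> \<Longrightarrow> reach 1 (While b p, \<sigma>) (Skip, \<sigma>)"
  by (rule reach_step) simp

section \<open>Loop-free programs and counting loops\<close>

fun loop_free :: "prog \<Rightarrow> bool" where
  "loop_free (Seq p q) \<longleftrightarrow> loop_free p \<and> loop_free q"
| "loop_free (Cond b p q) \<longleftrightarrow> loop_free p \<and> loop_free q"
| "loop_free (While b p) \<longleftrightarrow> False"
| "loop_free _ \<longleftrightarrow> True"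

text \<open>This lets the simplifier compute the effect of straight-line and branching code. On
  \<open>While\<close> the last equation is only a default value, and \<open>reach_loop_free\<close>
  excludes that case.\<close>

fun eff :: "prog \<Rightarrow> mem \<Rightarrow> mem" where
  "eff (Do i) \<sigma> = exec i \<sigma>"
| "eff (Seq p q) \<sigma> = eff q (eff p \<sigma>)"
| "eff (Cond b p q) \<sigma> = (if holds b \<sigma> then eff p \<sigma> else eff q \<sigma>)"
| "eff _ \<sigma> = \<sigma>"

fun dur :: "prog \<Rightarrow> nat" where
  "dur (Do i) = 1"
| "dur (Seq p q) = dur p + dur q + 1"
| "dur (Cond b p q) = max (dur p) (dur q) + 1"
| "dur _ = 0"

lemma reach_loop_free: "loop_free p \<Longrightarrow> reach (dur p) (p, \<sigma>) (Skip, eff p \<sigma>)"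
proof (induction p arbitrary: \<sigma>)
  case (Do i)
  show ?case using reach_step[of "(Do i, \<sigma>)"] by simp
next
  case (Seq p q)
  thus ?case using reach_Seq2[of "dur p" p \<sigma> "eff p \<sigma>" "dur q" q] by simp
next
  case (Cond b p q)
  show ?case
  proof (cases "holds b \<sigma>")
    case True
    have "reach (max (dur p) (dur q)) (p, \<sigma>) (Skip, eff p \<sigma>)"
      by (rule reach_mono[of "dur p"]) (use Cond in auto)
    thus ?thesis using True reach_Cond[of _ b \<sigma> p q] by simp
  next
    case False
    have "reach (max (dur p) (dur q)) (q, \<sigma>) (Skip, eff q \<sigma>)"
      by (rule reach_mono[of "dur q"]) (use Cond in auto)
    thus ?thesis using False reach_Cond[of _ b \<sigma> p q] by simp
  qed
qed (auto intro: reach_refl)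

text \<open>The body advances the counter itself, as the third assumption demands when applied to
  \<open>I (Suc j)\<close>. Each round costs two steps besides the body, and leaving the loop costs
  one.\<close>

lemma reach_For:
  assumes "loop_free p" "I 0 \<sigma>"
    and "\<And>j \<sigma>. I j \<sigma> \<Longrightarrow> nreg \<sigma> i = j \<and> nreg \<sigma> m = n"
    and "\<And>j \<sigma>. I j \<sigma> \<Longrightarrow> j < n \<Longrightarrow> I (Suc j) (eff p \<sigma>)"
  shows "\<exists>\<sigma>'. reach ((dur p + 2) * n + 1) (While (NLess i m) p, \<sigma>) (Skip, \<sigma>') \<and> I n \<sigma>'"
proof -
  have "\<exists>\<sigma>'. reach ((dur p + 2) * j) (While (NLess i m) p, \<sigma>) (While (NLess i m) p, \<sigma>') \<and> I j \<sigma>'"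
    if "j \<le> n" for j
    using that
  proof (induction j)
    case 0
    thus ?case using assms(2) reach_refl by auto
  next
    case (Suc j)
    then obtain \<sigma>' where 1: "reach ((dur p + 2) * j) (While (NLess i m) p, \<sigma>) (While (NLess i m) p, \<sigma>')"
      "I j \<sigma>'" by auto
    hence "holds (NLess i m) \<sigma>'" using assms(3)[of j \<sigma>'] Suc.prems by simp
    from reach_While_iter[OF this reach_loop_free[OF assms(1)]]
    have "reach (dur p + 2) (While (NLess i m) p, \<sigma>') (While (NLess i m) p, eff p \<sigma>')" .
    from reach_trans[OF 1(1) this] show ?case using assms(4)[OF 1(2)] Suc.prems
      by (auto simp: ac_simps)
  qed
  then obtain \<sigma>' where 1: "reach ((dur p + 2) * n) (While (NLess i m) p, \<sigma>) (While (NLess i m) p, \<sigma>')"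
      "I n \<sigma>'" by blast
  hence "\<not> holds (NLess i m) \<sigma>'" using assms(3)[of n \<sigma>'] by simp
  from reach_trans[OF 1(1) reach_While_exit[OF this]] 1(2) show ?thesis by blast
qed

fun block :: "instr list \<Rightarrow> prog" where
  "block [] = Skip"
| "block (i # is) = Seq (Do i) (block is)"

lemma loop_free_block [simp]: "loop_free (block is)"
  by (induction "is") auto

lemma dur_block [simp]: "dur (block is) = 2 * length is"
  by (induction "is") auto

lemma eff_block [simp]: "eff (block is) \<sigma> = fold exec is \<sigma>"
  by (induction "is" arbitrary: \<sigma>) auto

section \<open>The program\<close>

text \<open>All keys inserted after initialization equal the key extracted last, which is a lower bound
  of the queue.  So a stack of dynamically inserted nodes, always served first, together with the
  two sorted input lists, acts as the priority queue.

  Registers: 4 and 5 hold the constants 0 and 1, 6 and 7 the positions in the lists of min-nodes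
  and of edges, 8 the height of the stack, 9 is 1 until the queue is empty.  Arrays of naturals:
  6, 7, 8 hold node flags, edge flags and counters, 9 marks the max-nodes, 13 is the stack, and
  10, 11 (for min-nodes) and 14, 12 (for max-nodes) hold heads and links of linked lists of
  outgoing edges, where edge \<open>i\<close> is stored as \<open>i + 1\<close> and \<open>0\<close> is the end.  Array 3 of reals is the
  marking.\<close>

definition init_min :: prog where
  "init_min = block [NLoad 10 0 12, RLoad 1 0 12, RStore 3 10 1, NStore 6 10 4, NStore 9 10 4,
     NStore 10 10 4, NInc 12]"

definition init_max :: prog where
  "init_max = block [NLoad 10 1 12, RStore 3 10 0, NStore 8 10 4, NStore 9 10 5,
     NStore 14 10 4, NInc 12]"

text \<open>Each edge goes to the head of the list of its source, so the old head is copied into the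
  link before it is overwritten. Register 12, once incremented, is both the stored name
  \<open>i + 1\<close> of edge \<open>i\<close> and the next loop index.\<close>

definition init_min_edges :: prog where
  "init_min_edges = block [NLoad 10 2 12, NLoad 11 3 12, NStore 7 12 4, NLoad 13 8 11, NInc 13,
     NStore 8 11 13, NLoad 13 10 10, NStore 11 12 13, NInc 12, NStore 10 10 12]"

definition init_max_edges :: prog where
  "init_max_edges = block [NLoad 10 4 12, NLoad 13 14 10, NStore 12 12 13, NInc 12,
     NStore 14 10 12]"

text \<open>This pass is separate because the counters are known only after all edges have been
  read. The pushed nodes have key 0, the initial value of the current key.\<close>

definition init_stack :: prog where
  "init_stack = Seq (block [NLoad 10 1 12, NLoad 13 8 10])
     (Seq (Cond (NEq 13 4) (block [NStore 13 8 10, NInc 8]) Skip) (block [NInc 12]))"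

definition for_all :: "nat \<Rightarrow> prog \<Rightarrow> prog" where
  "for_all m p = Seq (block [NConst 12 0]) (While (NLess 12 m) p)"

definition init_prog :: prog where
  "init_prog =
     Seq (block [NConst 4 0, NConst 5 1, NConst 6 0, NConst 7 0, NConst 8 0, NConst 9 1, RZero 0])
    (Seq (for_all 0 init_min) (Seq (for_all 1 init_max) (Seq (for_all 2 init_min_edges)
    (Seq (for_all 3 init_max_edges) (for_all 1 init_stack)))))"

text \<open>Register 12 holds the edge \<open>\<langle>z,y\<rangle>\<close>, register 11 the node \<open>y\<close>, and the real register 0
  the new mark.\<close>

definition settle_prog :: prog where
  "settle_prog = Seq (block [NLoad 13 7 12]) (Cond (NEq 13 4)
     (Seq (block [RStore 3 11 0, NStore 7 12 5, NLoad 13 8 11, NDec 13, NStore 8 11 13])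
       (Cond (NEq 13 4) (block [NStore 13 8 11, NInc 8]) Skip))
     Skip)"

definition edge_prog :: prog where
  "edge_prog = Seq (block [NLoad 11 3 7, RLoad 0 1 7, NCopy 12 7, NInc 7]) settle_prog"

text \<open>Register 15 walks the list: \<open>NDec\<close> turns the stored \<open>i + 1\<close>
  into the index \<open>i\<close>, and the value 0 that ends the list also ends the loop
  \<open>While (NLess 4 15)\<close>.\<close>

definition min_body :: prog where
  "min_body = Seq (block [NCopy 12 15, NDec 12, NLoad 11 3 12])
     (Seq settle_prog (block [NLoad 15 11 12]))"

definition max_body :: prog where
  "max_body = Seq (block [NDec 15, NLoad 11 5 15, NLoad 13 6 11])
     (Seq (Cond (NEq 13 4)
        (Seq (block [RLoad 1 2 15])
          (Cond (RLess 0 1) (block [RStore 3 11 0, NStore 13 8 11, NInc 8]) Skip)) Skip)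
       (block [NLoad 15 12 15]))"

text \<open>Register 10 holds the extracted node.\<close>

definition node_prog :: prog where
  "node_prog = Seq (block [RLoad 0 3 10, NLoad 13 9 10]) (Cond (NEq 13 5)
     (Seq (block [NLoad 15 14 10]) (While (NLess 4 15) max_body))
     (Seq (block [NLoad 13 6 10]) (Cond (NEq 13 4)
       (Seq (block [NLoad 15 10 10]) (Seq (While (NLess 4 15) min_body) (block [NStore 6 10 5])))
       Skip)))"

definition list_node_prog :: prog where
  "list_node_prog = Seq (block [NLoad 10 0 6, NInc 6]) node_prog"

definition main_body :: prog where
  "main_body = Cond (NLess 4 8) (Seq (block [NDec 8, NLoad 10 13 8]) node_prog)
     (Cond (NLess 6 0)
       (Cond (NLess 7 2)
         (Seq (block [RLoad 0 0 6, RLoad 1 1 7]) (Cond (RLess 1 0) edge_prog list_node_prog))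
         list_node_prog)
       (Cond (NLess 7 2) edge_prog (block [NConst 9 0])))"

definition main_loop :: prog where
  "main_loop = While (NEq 9 5) main_body"

lemma loop_free_progs [simp]: "loop_free init_min" "loop_free init_max"
    "loop_free init_min_edges" "loop_free init_max_edges" "loop_free init_stack"
    "loop_free settle_prog" "loop_free edge_prog" "loop_free min_body" "loop_free max_body"
  by (simp_all add: init_min_def init_max_def init_min_edges_def init_max_edges_def init_stack_def
      settle_prog_def edge_prog_def min_body_def max_body_def)

lemma dur_progs [simp]: "dur init_min = 14" "dur init_max = 12"
    "dur init_min_edges = 20" "dur init_max_edges = 10" "dur init_stack = 13"
    "dur settle_prog = 20" "dur edge_prog = 29" "dur min_body = 30" "dur max_body = 21"
  by (simp_all add: init_min_def init_max_def init_min_edges_def init_max_edges_def init_stack_def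
      settle_prog_def edge_prog_def min_body_def max_body_def)

section \<open>Linked lists of outgoing edges\<close>

fun chain :: "(nat \<Rightarrow> nat) \<Rightarrow> nat \<Rightarrow> nat list \<Rightarrow> bool" where
  "chain nxt h [] \<longleftrightarrow> h = 0"
| "chain nxt h (i # is) \<longleftrightarrow> h = Suc i \<and> chain nxt (nxt i) is"

lemma chain_fun_upd: "i \<notin> set is \<Longrightarrow> chain (nxt(i := h')) h is \<longleftrightarrow> chain nxt h is"
  by (induction "is" arbitrary: h) auto

text \<open>The reversal reflects insertion at the head; \<open>n\<close> is the number of edges
  inserted so far.\<close>

definition out_edges :: "('v \<times> 'v) list \<Rightarrow> nat \<Rightarrow> 'v \<Rightarrow> nat list" where
  "out_edges es n z = rev (filter (\<lambda>i. fst (es ! i) = z) [0..<n])"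

lemma out_edges_0 [simp]: "out_edges es 0 z = []"
  by (simp add: out_edges_def)

lemma out_edges_Suc:
  "out_edges es (Suc n) z = (if fst (es ! n) = z then n # out_edges es n z else out_edges es n z)"
  by (simp add: out_edges_def)

lemma set_out_edges: "set (out_edges es n z) = {i. i < n \<and> fst (es ! i) = z}"
  by (auto simp: out_edges_def)

lemma distinct_targets:
  assumes "distinct es"
  shows "distinct (map (\<lambda>i. snd (es ! i)) (out_edges es (length es) z))"
  unfolding distinct_map
proof
  show "inj_on (\<lambda>i. snd (es ! i)) (set (out_edges es (length es) z))"
    using assms by (auto simp: inj_on_def set_out_edges prod_eq_iff nth_eq_iff_index_eq[symmetric])
qed (simp add: out_edges_def)

lemma set_targets:
  "set (map (\<lambda>i. snd (es ! i)) (out_edges es (length es) z)) = {y. (z, y) \<in> set es}"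
proof
  show "{y. (z, y) \<in> set es} \<subseteq> set (map (\<lambda>i. snd (es ! i)) (out_edges es (length es) z))"
    by (force simp: set_out_edges in_set_conv_nth)
qed (use nth_mem in \<open>fastforce simp: set_out_edges\<close>)

section \<open>Simulation of the main loop\<close>

locale presented = minimax N for N :: "'v net" +
  fixes code :: "'v \<Rightarrow> nat" and xs ys :: "'v list" and es fs :: "('v \<times> 'v) list"
  assumes pres: "presentation N code xs ys es fs"
begin

lemma code_inj: "v \<in> nodes N \<Longrightarrow> w \<in> nodes N \<Longrightarrow> code v = code w \<longleftrightarrow> v = w"
  and xs: "distinct xs" "set xs = Vmin N" "sorted (map (lim N) xs)"
  and ys: "distinct ys" "set ys = Vmax N"
  and es: "distinct es" "sorted (map (\<lambda>(z, y). wt N z y) es)"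
  and fs: "distinct fs"
  using pres unfolding presentation_def bij_betw_def inj_on_def by auto

lemma set_es: "set es = {(z, y). z \<in> Vmin N \<and> y \<in> Vmax N \<and> wt N z y > 0}"
  and set_fs: "set fs = {(z, y). z \<in> Vmax N \<and> y \<in> Vmin N \<and> wt N z y > 0}"
  using pres Vmin_Vmax unfolding presentation_def pos_edges_def by auto

lemma xs_nth: "i < length xs \<Longrightarrow> xs ! i \<in> Vmin N \<and> xs ! i \<in> nodes N"
  and ys_nth: "i < length ys \<Longrightarrow> ys ! i \<in> Vmax N \<and> ys ! i \<in> nodes N"
  using nth_mem[of i xs] nth_mem[of i ys] xs ys by (auto simp: nodes_def)

lemma es_nth: "i < length es \<Longrightarrow> fst (es ! i) \<in> Vmin N \<and> fst (es ! i) \<in> nodes N \<and>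
    snd (es ! i) \<in> Vmax N \<and> snd (es ! i) \<in> nodes N"
  using nth_mem[of i es] by (auto simp: set_es nodes_def)

lemma fs_nth: "i < length fs \<Longrightarrow> fst (fs ! i) \<in> Vmax N \<and> fst (fs ! i) \<in> nodes N \<and>
    snd (fs ! i) \<in> Vmin N \<and> snd (fs ! i) \<in> nodes N"
  using nth_mem[of i fs] by (auto simp: set_fs nodes_def)

lemma in_nodes: "v \<in> Vmin N \<Longrightarrow> v \<in> nodes N" "v \<in> Vmax N \<Longrightarrow> v \<in> nodes N"
  by (auto simp: nodes_def)

section \<open>Relation between machine memory and algorithm state\<close>

definition static :: "mem \<Rightarrow> bool" where
  "static \<sigma> \<longleftrightarrow> input_memory N code xs ys es fs \<sigma> \<and> nreg \<sigma> 4 = 0 \<and> nreg \<sigma> 5 = 1 \<and>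
     (\<forall>v \<in> nodes N. narr \<sigma> 9 (code v) = of_bool (v \<in> Vmax N)) \<and>
     (\<forall>z \<in> Vmin N. chain (narr \<sigma> 11) (narr \<sigma> 10 (code z)) (out_edges es (length es) z)) \<and>
     (\<forall>z \<in> Vmax N. chain (narr \<sigma> 12) (narr \<sigma> 14 (code z)) (out_edges fs (length fs) z))"

text \<open>The arrays excepted here and the registers from 6 on are all that the main loop writes,
  so its fragments preserve \<open>static\<close> by inspection.\<close>

lemma static_cong:
  assumes "static \<sigma>" "\<And>i. i < 6 \<Longrightarrow> nreg \<sigma>' i = nreg \<sigma> i"
    "\<And>i. i \<notin> {6, 7, 8, 13} \<Longrightarrow> narr \<sigma>' i = narr \<sigma> i" "\<And>i. i \<noteq> 3 \<Longrightarrow> rarr \<sigma>' i = rarr \<sigma> i"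
  shows "static \<sigma>'"
  using assms unfolding static_def input_memory_def by simp

text \<open>All entries on the stack have the same key \<open>k\<close>, so no keys need to be
  stored with them. A lowered min-node is pushed while its entry in \<open>xs\<close>, if not yet
  reached, stays there; this yields the repeated occurrences of the queue.\<close>

definition listed :: "nat \<Rightarrow> nat \<Rightarrow> 'v list \<Rightarrow> real \<Rightarrow> ('v obj \<times> real) multiset" where
  "listed ix ie st k = mset (map (\<lambda>x. (Node x, lim N x)) (drop ix xs)) +
     mset (map (\<lambda>(z, y). (Edge z y, wt N z y)) (drop ie es)) +
     mset (map (\<lambda>v. (Node v, k)) st)"

definition stacked :: "mem \<Rightarrow> 'v list \<Rightarrow> bool" where
  "stacked \<sigma> st \<longleftrightarrow> set st \<subseteq> nodes N \<and> nreg \<sigma> 8 = length st \<and>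
     (\<forall>j < length st. narr \<sigma> 13 j = code (st ! j))"

definition linked :: "mem \<Rightarrow> 'v alg_state \<Rightarrow> real \<Rightarrow> bool" where
  "linked \<sigma> s k \<longleftrightarrow> represents N code es 3 6 7 8 \<sigma> s \<and>
     nreg \<sigma> 6 \<le> length xs \<and> nreg \<sigma> 7 \<le> length es \<and>
     (\<exists>st. stacked \<sigma> st \<and> queue s = listed (nreg \<sigma> 6) (nreg \<sigma> 7) st k)"

lemma linked_cong:
  assumes "linked \<sigma> s k" "\<And>i. i \<in> {6, 7, 8} \<Longrightarrow> nreg \<sigma>' i = nreg \<sigma> i"
    "\<And>i. i \<in> {6, 7, 8, 13} \<Longrightarrow> narr \<sigma>' i = narr \<sigma> i" "rarr \<sigma>' 3 = rarr \<sigma> 3"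
  shows "linked \<sigma>' s k"
  using assms unfolding linked_def represents_def stacked_def by simp

lemma stacked_push:
  assumes "stacked \<sigma> st" "v \<in> nodes N" "nreg \<sigma>' 8 = Suc (nreg \<sigma> 8)"
    "narr \<sigma>' 13 = (narr \<sigma> 13)(nreg \<sigma> 8 := code v)"
  shows "stacked \<sigma>' (st @ [v])"
  using assms unfolding stacked_def by (auto simp: nth_append less_Suc_eq)

lemma listed_push: "listed ix ie (st @ [v]) k = add_mset (Node v, k) (listed ix ie st k)"
  by (simp add: listed_def)

text \<open>Pushing \<open>y\<close> preserves \<open>linked\<close> because the new mark is
  \<open>k\<close>, the common key of the stack. The preserved registers carry the loop flag, the
  extracted node and the position in the edge list past this fragment.\<close>

lemma settle_prog_correct:
  assumes "static \<sigma>" "linked \<sigma> s k" and i: "nreg \<sigma> 12 < length es" "es ! nreg \<sigma> 12 = (z, y)"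
    and "nreg \<sigma> 11 = code y" "rreg \<sigma> 0 = k"
  shows "static (eff settle_prog \<sigma>) \<and> linked (eff settle_prog \<sigma>) (settle z y k s) k \<and>
    (\<forall>i \<in> {9, 10, 12, 15}. nreg (eff settle_prog \<sigma>) i = nreg \<sigma> i) \<and>
    narr (eff settle_prog \<sigma>) 11 = narr \<sigma> 11 \<and> rreg (eff settle_prog \<sigma>) 0 = k"
proof -
  have z: "z \<in> Vmin N" "z \<in> nodes N" and y: "y \<in> Vmax N" "y \<in> nodes N"
    using es_nth[OF i(1)] i(2) by auto
  have c: "nreg \<sigma> 4 = 0" "nreg \<sigma> 5 = 1" using assms(1) by (auto simp: static_def)
  have r: "narr \<sigma> 7 (nreg \<sigma> 12) = of_bool (edge_done s (z, y))" "narr \<sigma> 8 (code y) = cnt s y"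
    using assms(2) i y unfolding linked_def represents_def by auto
  obtain st where st: "stacked \<sigma> st" "queue s = listed (nreg \<sigma> 6) (nreg \<sigma> 7) st k"
    using assms(2) unfolding linked_def by blast
  \<comment> \<open>The entries of \<open>es\<close> are distinct, so the store at this position
    changes the flag of one edge only.\<close>
  have idx: "es ! j = (z, y) \<longleftrightarrow> j = nreg \<sigma> 12" if "j < length es" for j
    using nth_eq_iff_index_eq[OF es(1) that i(1)] i(2) by simp
  let ?\<sigma> = "eff settle_prog \<sigma>"
  have stat: "static ?\<sigma>"
    by (rule static_cong[OF assms(1)]) (auto simp: settle_prog_def)
  have rest: "(\<forall>i \<in> {9, 10, 12, 15}. nreg ?\<sigma> i = nreg \<sigma> i) \<and> narr ?\<sigma> 11 = narr \<sigma> 11 \<and>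
      rreg ?\<sigma> 0 = k"
    using assms by (auto simp: settle_prog_def)
  have "linked ?\<sigma> (settle z y k s) k"
  proof (cases "edge_done s (z, y)")
    case True
    hence "settle z y k s = s" by (simp add: settle_def)
    moreover have "linked ?\<sigma> s k"
      by (rule linked_cong[OF assms(2)]) (use True r c in \<open>auto simp: settle_prog_def\<close>)
    ultimately show ?thesis by simp
  next
    case False
    have rep: "represents N code es 3 6 7 8 ?\<sigma> (settle z y k s)"
      using assms(2,4-) False r c y in_nodes
      unfolding linked_def represents_def
      by (auto simp: settle_prog_def settle_def insert_node_def Let_def code_inj idx)
    have n: "nreg ?\<sigma> 6 = nreg \<sigma> 6" "nreg ?\<sigma> 7 = nreg \<sigma> 7" by (auto simp: settle_prog_def)
    show ?thesis
    proof (cases "cnt s y - 1 = 0")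
      case True
      have "stacked ?\<sigma> (st @ [y])"
        by (rule stacked_push[OF st(1) y(2)]) (use True False r c assms(5) in \<open>auto simp: settle_prog_def\<close>)
      moreover have "queue (settle z y k s) = listed (nreg \<sigma> 6) (nreg \<sigma> 7) (st @ [y]) k"
        using True False st(2) by (simp add: listed_push settle_def insert_node_def Let_def)
      ultimately show ?thesis using rep assms(2) n unfolding linked_def by auto
    next
      case nz: False
      have "stacked ?\<sigma> st"
        using st(1) nz False r c assms(5) unfolding stacked_def by (auto simp: settle_prog_def)
      moreover have "queue (settle z y k s) = listed (nreg \<sigma> 6) (nreg \<sigma> 7) st k"
        using nz False st(2) by (simp add: settle_def Let_def)
      ultimately show ?thesis using rep assms(2) n unfolding linked_def by auto
    qed
  qed
  thus ?thesis using stat rest by blast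
qed

text \<open>Real register 0 can keep the mark of \<open>z\<close> for the whole loop, since the
  targets are max-nodes and settling them leaves \<open>mark s z\<close> alone. A round takes the 30
  steps of \<open>min_body\<close> and 2 more.\<close>

lemma min_loop:
  assumes "static \<sigma>" "linked \<sigma> s k" "chain (narr \<sigma> 11) (nreg \<sigma> 15) is"
    "set is \<subseteq> {i. i < length es \<and> fst (es ! i) = z}" "rreg \<sigma> 0 = k" "mark s z = k"
  shows "\<exists>\<sigma>'. reach (32 * length is + 1) (While (NLess 4 15) min_body, \<sigma>) (Skip, \<sigma>') \<and>
    static \<sigma>' \<and> nreg \<sigma>' 9 = nreg \<sigma> 9 \<and> nreg \<sigma>' 10 = nreg \<sigma> 10 \<and>
    linked \<sigma>' (fold (\<lambda>y t. settle z y (mark t z) t) (map (\<lambda>i. snd (es ! i)) is) s) k"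
  using assms
proof (induction "is" arbitrary: \<sigma> s)
  case Nil
  thus ?case using reach_While_exit[of "NLess 4 15" \<sigma> min_body] by auto
next
  case (Cons i "is")
  define y where "y = snd (es ! i)"
  have i: "i < length es" "es ! i = (z, y)" using Cons.prems by (auto simp: y_def)
  hence yz: "y \<noteq> z" using es_nth[OF i(1)] Vmin_Vmax by auto
  define \<sigma>1 where "\<sigma>1 = eff (block [NCopy 12 15, NDec 12, NLoad 11 3 12]) \<sigma>"
  define \<sigma>2 where "\<sigma>2 = eff settle_prog \<sigma>1"
  define \<sigma>3 where "\<sigma>3 = eff (block [NLoad 15 11 12]) \<sigma>2"
  have h: "nreg \<sigma> 15 = Suc i" "chain (narr \<sigma> 11) (narr \<sigma> 11 i) is" "nreg \<sigma> 4 = 0"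
    using Cons.prems by (auto simp: static_def)
  have a: "narr \<sigma> 3 i = code y" using Cons.prems(1) i by (auto simp: static_def input_memory_def)
  have s1: "static \<sigma>1" "linked \<sigma>1 s k"
    by (rule static_cong[OF Cons.prems(1)], auto simp: \<sigma>1_def)
      (rule linked_cong[OF Cons.prems(2)], auto)
  have r1: "nreg \<sigma>1 12 = i" "nreg \<sigma>1 11 = code y" "rreg \<sigma>1 0 = k" "narr \<sigma>1 11 = narr \<sigma> 11"
      "nreg \<sigma>1 9 = nreg \<sigma> 9" "nreg \<sigma>1 10 = nreg \<sigma> 10"
    using h a Cons.prems by (auto simp: \<sigma>1_def)
  have s2: "static \<sigma>2" "linked \<sigma>2 (settle z y k s) k" "narr \<sigma>2 11 = narr \<sigma> 11" "rreg \<sigma>2 0 = k"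
      "nreg \<sigma>2 9 = nreg \<sigma> 9" "nreg \<sigma>2 10 = nreg \<sigma> 10" "nreg \<sigma>2 12 = i"
    using settle_prog_correct[OF s1, of z y] r1 i unfolding \<sigma>2_def by auto
  have s3: "static \<sigma>3" "linked \<sigma>3 (settle z y k s) k"
    by (rule static_cong[OF s2(1)], auto simp: \<sigma>3_def)
      (rule linked_cong[OF s2(2)], auto)
  have m: "mark (settle z y k s) z = k"
    using Cons.prems yz by (auto simp: settle_def insert_node_def Let_def)
  have e: "eff min_body \<sigma> = \<sigma>3"
    by (simp add: \<sigma>3_def \<sigma>2_def \<sigma>1_def min_body_def)
  have "holds (NLess 4 15) \<sigma>" using h by simp
  from reach_While_iter[OF this reach_loop_free[of min_body]]
  have R: "reach 32 (While (NLess 4 15) min_body, \<sigma>) (While (NLess 4 15) min_body, \<sigma>3)"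
    by (simp add: e)
  have "chain (narr \<sigma>3 11) (nreg \<sigma>3 15) is" "rreg \<sigma>3 0 = k" "nreg \<sigma>3 9 = nreg \<sigma> 9"
      "nreg \<sigma>3 10 = nreg \<sigma> 10"
    using s2 h by (auto simp: \<sigma>3_def)
  from Cons.IH[OF s3 this(1) _ this(2) m] Cons.prems(4) this(3,4)
  obtain \<sigma>' where \<sigma>': "reach (32 * length is + 1) (While (NLess 4 15) min_body, \<sigma>3) (Skip, \<sigma>')"
    "static \<sigma>'" "nreg \<sigma>' 9 = nreg \<sigma> 9" "nreg \<sigma>' 10 = nreg \<sigma> 10"
    "linked \<sigma>' (fold (\<lambda>y t. settle z y (mark t z) t) (map (\<lambda>i. snd (es ! i)) is) (settle z y k s)) k"
    by auto
  show ?case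
    by (intro exI[of _ \<sigma>'])
      (use reach_trans[OF R \<sigma>'(1)] \<sigma>'(2-) Cons.prems(6) in \<open>simp add: y_def\<close>)
qed

text \<open>Lowered nodes receive the mark of \<open>z\<close>, which is \<open>k\<close>, and so
  fit on the stack. A round takes 21 + 2 steps.\<close>

lemma max_loop:
  assumes "static \<sigma>" "linked \<sigma> s k" "chain (narr \<sigma> 12) (nreg \<sigma> 15) is"
    "set is \<subseteq> {i. i < length fs \<and> fst (fs ! i) = z}" "rreg \<sigma> 0 = k" "mark s z = k"
  shows "\<exists>\<sigma>'. reach (23 * length is + 1) (While (NLess 4 15) max_body, \<sigma>) (Skip, \<sigma>') \<and>
    static \<sigma>' \<and> nreg \<sigma>' 9 = nreg \<sigma> 9 \<and>
    linked \<sigma>' (fold (lower N z) (map (\<lambda>i. snd (fs ! i)) is) s) k"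
  using assms
proof (induction "is" arbitrary: \<sigma> s)
  case Nil
  thus ?case using reach_While_exit[of "NLess 4 15" \<sigma> max_body] by auto
next
  case (Cons i "is")
  define x where "x = snd (fs ! i)"
  have i: "i < length fs" "fs ! i = (z, x)" using Cons.prems by (auto simp: x_def)
  hence z: "z \<in> Vmax N" "z \<in> nodes N" and x: "x \<in> Vmin N" "x \<in> nodes N"
    using fs_nth[OF i(1)] by auto
  hence xz: "x \<noteq> z" using Vmin_Vmax by auto
  define \<sigma>1 where "\<sigma>1 = eff max_body \<sigma>"
  have h: "nreg \<sigma> 15 = Suc i" "chain (narr \<sigma> 12) (narr \<sigma> 12 i) is" "nreg \<sigma> 4 = 0"
    using Cons.prems by (auto simp: static_def)
  have a: "narr \<sigma> 5 i = code x" "rarr \<sigma> 2 i = wt N z x"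
    using Cons.prems(1) i by (auto simp: static_def input_memory_def)
  have d: "narr \<sigma> 6 (code x) = of_bool (node_done s x)"
    using Cons.prems(2) x by (auto simp: linked_def represents_def)
  obtain st where st: "stacked \<sigma> st" "queue s = listed (nreg \<sigma> 6) (nreg \<sigma> 7) st k"
    using Cons.prems(2) unfolding linked_def by blast
  have s1: "static \<sigma>1"
    by (rule static_cong[OF Cons.prems(1)]) (auto simp: \<sigma>1_def max_body_def)
  have l1: "linked \<sigma>1 (lower N z x s) k"
  proof (cases "\<not> node_done s x \<and> wt N z x > k")
    case True
    have "stacked \<sigma>1 (st @ [x])"
      by (rule stacked_push[OF st(1) x(2)])
        (use True h a d Cons.prems(5) in \<open>auto simp: \<sigma>1_def max_body_def\<close>)
    moreover have "queue (lower N z x s) = listed (nreg \<sigma> 6) (nreg \<sigma> 7) (st @ [x]) k"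
      using True st(2) Cons.prems(6) by (simp add: listed_push lower_def insert_node_def)
    moreover have "represents N code es 3 6 7 8 \<sigma>1 (lower N z x s)"
      using Cons.prems(2,5,6) True h a d x in_nodes unfolding linked_def represents_def
      by (auto simp: \<sigma>1_def max_body_def lower_def insert_node_def code_inj)
    moreover have "nreg \<sigma>1 6 = nreg \<sigma> 6" "nreg \<sigma>1 7 = nreg \<sigma> 7"
      by (auto simp: \<sigma>1_def max_body_def)
    ultimately show ?thesis using Cons.prems(2) unfolding linked_def by auto
  next
    case False
    hence "lower N z x s = s" using Cons.prems(6) by (auto simp: lower_def)
    moreover have "linked \<sigma>1 s k"
      by (rule linked_cong[OF Cons.prems(2)])
        (use False h a d Cons.prems(5) in \<open>auto simp: \<sigma>1_def max_body_def\<close>)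
    ultimately show ?thesis by simp
  qed
  have m: "mark (lower N z x s) z = k"
    using Cons.prems(6) xz by (auto simp: lower_def insert_node_def)
  have "holds (NLess 4 15) \<sigma>" using h by simp
  from reach_While_iter[OF this reach_loop_free[of max_body]]
  have R: "reach 23 (While (NLess 4 15) max_body, \<sigma>) (While (NLess 4 15) max_body, \<sigma>1)"
    by (simp add: \<sigma>1_def)
  have "chain (narr \<sigma>1 12) (nreg \<sigma>1 15) is" "rreg \<sigma>1 0 = k" "nreg \<sigma>1 9 = nreg \<sigma> 9"
    using h Cons.prems(5) by (auto simp: \<sigma>1_def max_body_def)
  from Cons.IH[OF s1 l1 this(1) _ this(2) m] Cons.prems(4) this(3)
  obtain \<sigma>' where \<sigma>': "reach (23 * length is + 1) (While (NLess 4 15) max_body, \<sigma>1) (Skip, \<sigma>')"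
    "static \<sigma>'" "nreg \<sigma>' 9 = nreg \<sigma> 9"
    "linked \<sigma>' (fold (lower N z) (map (\<lambda>i. snd (fs ! i)) is) (lower N z x s)) k"
    by auto
  show ?case
    by (intro exI[of _ \<sigma>'])
      (use reach_trans[OF R \<sigma>'(1)] \<sigma>'(2-) in \<open>simp add: x_def\<close>)
qed

text \<open>The order \<open>vs\<close>, which the algorithm leaves open, is the one in which the
  linked list stores the edges of \<open>z\<close>. The condition \<open>key\<close> is restricted
  because an outdated entry says nothing about the mark of a finished node. The constant 40 is
  generous for the fixed part; being at least 32, it keeps the time of a scan below
  \<open>40 * (1 + card (Succ N z))\<close>.\<close>

lemma node_prog_correct:
  assumes "static \<sigma>" "linked \<sigma> s k" "z \<in> nodes N" "nreg \<sigma> 10 = code z"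
    and key: "z \<in> Vmax N \<or> \<not> node_done s z \<Longrightarrow> mark s z = k"
  shows "\<exists>\<sigma>' vs. distinct vs \<and> set vs = Succ N z \<and>
    reach (40 + (if z \<in> Vmax N \<or> \<not> node_done s z then 32 * card (Succ N z) else 0))
      (node_prog, \<sigma>) (Skip, \<sigma>') \<and>
    static \<sigma>' \<and> nreg \<sigma>' 9 = nreg \<sigma> 9 \<and> linked \<sigma>' (process_node N z vs s) k"
proof -
  define \<sigma>1 where "\<sigma>1 = eff (block [RLoad 0 3 10, NLoad 13 9 10]) \<sigma>"
  define \<sigma>2 where "\<sigma>2 = eff (block [NLoad 15 14 10]) \<sigma>1"
  define \<sigma>3 where "\<sigma>3 = eff (block [NLoad 13 6 10]) \<sigma>1"
  define \<sigma>4 where "\<sigma>4 = eff (block [NLoad 15 10 10]) \<sigma>3"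
  have R1: "reach 4 (block [RLoad 0 3 10, NLoad 13 9 10], \<sigma>) (Skip, \<sigma>1)"
    using reach_loop_free[of "block [RLoad 0 3 10, NLoad 13 9 10]" \<sigma>]
    unfolding \<sigma>1_def by (simp del: block.simps eff_block)
  have R2: "reach 2 (block [NLoad 15 14 10], \<sigma>1) (Skip, \<sigma>2)"
    using reach_loop_free[of "block [NLoad 15 14 10]" \<sigma>1]
    unfolding \<sigma>2_def by (simp del: block.simps eff_block)
  have R3: "reach 2 (block [NLoad 13 6 10], \<sigma>1) (Skip, \<sigma>3)"
    using reach_loop_free[of "block [NLoad 13 6 10]" \<sigma>1]
    unfolding \<sigma>3_def by (simp del: block.simps eff_block)
  have R4: "reach 2 (block [NLoad 15 10 10], \<sigma>3) (Skip, \<sigma>4)"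
    using reach_loop_free[of "block [NLoad 15 10 10]" \<sigma>3]
    unfolding \<sigma>4_def by (simp del: block.simps eff_block)
  have mk: "rreg \<sigma>1 0 = mark s z" "nreg \<sigma>1 13 = of_bool (z \<in> Vmax N)" "nreg \<sigma>1 5 = 1"
    using assms by (auto simp: \<sigma>1_def static_def linked_def represents_def)
  have stat: "static \<sigma>1" "static \<sigma>2" "static \<sigma>3" "static \<sigma>4"
    by (rule static_cong[OF assms(1)]; simp add: \<sigma>1_def \<sigma>2_def \<sigma>3_def \<sigma>4_def)+
  have link: "linked \<sigma>1 s k" "linked \<sigma>2 s k" "linked \<sigma>3 s k" "linked \<sigma>4 s k"
    by (rule linked_cong[OF assms(2)]; force simp: \<sigma>1_def \<sigma>2_def \<sigma>3_def \<sigma>4_def)+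
  have n9: "nreg \<sigma>1 9 = nreg \<sigma> 9" "nreg \<sigma>2 9 = nreg \<sigma> 9" "nreg \<sigma>3 9 = nreg \<sigma> 9" "nreg \<sigma>4 9 = nreg \<sigma> 9"
    by (simp_all add: \<sigma>1_def \<sigma>2_def \<sigma>3_def \<sigma>4_def)
  show ?thesis
  proof (cases "z \<in> Vmax N")
    case True
    define vs where "vs = map (\<lambda>i. snd (fs ! i)) (out_edges fs (length fs) z)"
    have vs: "distinct vs" "set vs = Succ N z"
      unfolding vs_def using distinct_targets[OF fs] True
      by (simp_all only: set_targets) (auto simp: set_fs Succ_max)
    hence len: "length (out_edges fs (length fs) z) = card (Succ N z)"
      using distinct_card[of vs] by (simp add: vs_def)
    have "chain (narr \<sigma>2 12) (nreg \<sigma>2 15) (out_edges fs (length fs) z)" "rreg \<sigma>2 0 = k"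
      using assms(1,4) True mk key by (auto simp: \<sigma>2_def \<sigma>1_def static_def)
    from max_loop[OF stat(2) link(2) this(1) _ this(2) key] True obtain \<sigma>' where
      \<sigma>': "reach (23 * card (Succ N z) + 1) (While (NLess 4 15) max_body, \<sigma>2) (Skip, \<sigma>')"
      "static \<sigma>'" "nreg \<sigma>' 9 = nreg \<sigma> 9" "linked \<sigma>' (fold (lower N z) vs s) k"
      by (auto simp: set_out_edges len vs_def n9)
    have "holds (NEq 13 5) \<sigma>1" using True mk by simp
    \<comment> \<open>The sum follows the syntax tree, with one step for each \<open>Seq\<close> and
      each \<open>Cond\<close> on the path.\<close>
    hence "reach (4 + ((2 + (23 * card (Succ N z) + 1) + 1) + 1) + 1) (node_prog, \<sigma>) (Skip, \<sigma>')"
      unfolding node_prog_def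
      by (intro reach_Seq2[OF R1] reach_Cond) (simp only: if_True, rule reach_Seq2[OF R2 \<sigma>'(1)])
    hence "reach (40 + 32 * card (Succ N z)) (node_prog, \<sigma>) (Skip, \<sigma>')"
      by (rule reach_mono) simp
    thus ?thesis using vs \<sigma>' True by (intro exI[of _ \<sigma>'] exI[of _ vs]) (simp add: process_node_def)
  next
    case False
    hence z: "z \<in> Vmin N" using assms(3) by (simp add: nodes_def)
    define vs where "vs = map (\<lambda>i. snd (es ! i)) (out_edges es (length es) z)"
    have vs: "distinct vs" "set vs = Succ N z"
      unfolding vs_def using distinct_targets[OF es(1)] z
      by (simp_all only: set_targets) (auto simp: set_es Succ_min)
    hence len: "length (out_edges es (length es) z) = card (Succ N z)"
      using distinct_card[of vs] by (simp add: vs_def)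
    have nh: "\<not> holds (NEq 13 5) \<sigma>1" using False mk by simp
    have d: "nreg \<sigma>3 13 = of_bool (node_done s z)" "nreg \<sigma>3 4 = 0"
      using z assms by (auto simp: \<sigma>3_def \<sigma>1_def linked_def represents_def static_def)
    let ?p = "Seq (block [NLoad 15 10 10]) (Seq (While (NLess 4 15) min_body) (block [NStore 6 10 5]))"
    show ?thesis
    proof (cases "node_done s z")
      case True
      have "\<not> holds (NEq 13 4) \<sigma>3" using True d by simp
      hence "reach (2 + (0 + 1) + 1) (Seq (block [NLoad 13 6 10]) (Cond (NEq 13 4) ?p Skip), \<sigma>1) (Skip, \<sigma>3)"
        by (intro reach_Seq2[OF R3] reach_Cond) (simp only: if_False reach_refl)
      hence "reach (4 + ((2 + (0 + 1) + 1) + 1) + 1) (node_prog, \<sigma>) (Skip, \<sigma>3)"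
        unfolding node_prog_def using nh
        by (intro reach_Seq2[OF R1] reach_Cond) (simp only: if_False)
      hence "reach 40 (node_prog, \<sigma>) (Skip, \<sigma>3)" by (rule reach_mono) simp
      thus ?thesis using vs stat link n9 True False
        by (intro exI[of _ \<sigma>3] exI[of _ vs]) (simp add: process_node_def)
    next
      case undone: False
      have "chain (narr \<sigma>4 11) (nreg \<sigma>4 15) (out_edges es (length es) z)" "rreg \<sigma>4 0 = k"
        using assms(1,4) z undone mk key by (auto simp: \<sigma>4_def \<sigma>3_def \<sigma>1_def static_def)
      moreover have r10: "nreg \<sigma>4 10 = code z" using assms(4) by (simp add: \<sigma>4_def \<sigma>3_def \<sigma>1_def)
      moreover define s' where "s' = fold (\<lambda>y t. settle z y (mark t z) t) vs s"
      ultimately obtain \<sigma>' where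
        \<sigma>': "reach (32 * card (Succ N z) + 1) (While (NLess 4 15) min_body, \<sigma>4) (Skip, \<sigma>')"
        "static \<sigma>'" "nreg \<sigma>' 9 = nreg \<sigma> 9" "nreg \<sigma>' 10 = code z" "linked \<sigma>' s' k"
        using min_loop[OF stat(4) link(4), of "out_edges es (length es) z" z] undone key
        by (auto simp: set_out_edges len vs_def n9)
      define \<sigma>5 where "\<sigma>5 = eff (block [NStore 6 10 5]) \<sigma>'"
      have R5: "reach 2 (block [NStore 6 10 5], \<sigma>') (Skip, \<sigma>5)"
        using reach_loop_free[of "block [NStore 6 10 5]" \<sigma>']
        unfolding \<sigma>5_def by (simp del: block.simps eff_block)
      have "holds (NEq 13 4) \<sigma>3" using undone d by simp
      hence "reach (2 + ((2 + ((32 * card (Succ N z) + 1) + 2 + 1) + 1) + 1) + 1)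
          (Seq (block [NLoad 13 6 10]) (Cond (NEq 13 4) ?p Skip), \<sigma>1) (Skip, \<sigma>5)"
        by (intro reach_Seq2[OF R3] reach_Cond)
          (simp only: if_True, rule reach_Seq2[OF R4 reach_Seq2[OF \<sigma>'(1) R5]])
      hence "reach (4 + ((2 + ((2 + ((32 * card (Succ N z) + 1) + 2 + 1) + 1) + 1) + 1) + 1) + 1)
          (node_prog, \<sigma>) (Skip, \<sigma>5)"
        unfolding node_prog_def using nh
        by (intro reach_Seq2[OF R1] reach_Cond) (simp only: if_False)
      hence R: "reach (40 + 32 * card (Succ N z)) (node_prog, \<sigma>) (Skip, \<sigma>5)"
        by (rule reach_mono) simp
      have s5: "static \<sigma>5" by (rule static_cong[OF \<sigma>'(2)]) (auto simp: \<sigma>5_def)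
      have "nreg \<sigma>' 5 = 1" using \<sigma>'(2) by (simp add: static_def)
      hence "linked \<sigma>5 (s'\<lparr>node_done := (node_done s')(z := True)\<rparr>) k"
        using \<sigma>'(4,5) assms(3) in_nodes unfolding linked_def represents_def stacked_def
        by (auto simp: \<sigma>5_def code_inj)
      moreover have "process_node N z vs s = s'\<lparr>node_done := (node_done s')(z := True)\<rparr>"
        using False undone by (simp add: process_node_def s'_def Let_def)
      moreover have "nreg \<sigma>5 9 = nreg \<sigma> 9" using \<sigma>'(3) by (simp add: \<sigma>5_def)
      ultimately show ?thesis using R s5 vs undone
        by (intro exI[of _ \<sigma>5] exI[of _ vs]) simp
    qed
  qed
qed

section \<open>Iterations of the main loop on the machine\<close>

lemma linked_rekey: "linked \<sigma> s k \<Longrightarrow> nreg \<sigma> 8 = 0 \<Longrightarrow> linked \<sigma> s k'"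
  unfolding linked_def stacked_def listed_def by fastforce

text \<open>Both remaining lists are sorted, so with an empty stack it suffices to compare their
  heads.\<close>

lemma listed_min:
  assumes "(ob, k') \<in># listed ix ie [] k"
  shows "ix < length xs \<and> lim N (xs ! ix) \<le> k' \<or>
    ie < length es \<and> wt N (fst (es ! ie)) (snd (es ! ie)) \<le> k'"
proof -
  from assms consider x where "x \<in> set (drop ix xs)" "k' = lim N x"
    | e where "e \<in> set (drop ie es)" "k' = wt N (fst e) (snd e)"
    unfolding listed_def by auto
  thus ?thesis
  proof cases
    case 1
    then obtain j where "j < length xs - ix" "k' = lim N (xs ! (ix + j))"
      by (auto simp: in_set_conv_nth)
    thus ?thesis using sorted_nth_mono[OF xs(3), of ix "ix + j"] by auto
  next
    case 2
    then obtain j where "j < length es - ie" "k' = wt N (fst (es ! (ie + j))) (snd (es ! (ie + j)))"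
      by (auto simp: in_set_conv_nth)
    thus ?thesis using sorted_nth_mono[OF es(2), of ie "ie + j"] by (auto simp: case_prod_beta)
  qed
qed

lemma represents_queue [simp]:
  "represents N code es aM aD aF aC \<sigma> (s\<lparr>queue := q\<rparr>) \<longleftrightarrow> represents N code es aM aD aF aC \<sigma> s"
  by (simp add: represents_def)

text \<open>Time is charged to the potential here. By \<open>process_node_inv\<close> it drops by at
  least 1, and by at least \<open>1 + card (Succ N z)\<close> when the edges of \<open>z\<close> are
  scanned, which covers the bound of \<open>node_prog_correct\<close> at rate 40.\<close>

lemma node_step:
  assumes "static \<sigma>" "linked \<sigma> (s\<lparr>queue := queue s - {#(Node z, k)#}\<rparr>) k"
    "nreg \<sigma> 10 = code z"
    and inv: "alg_inv N s k\<^sub>0" and pop: "(Node z, k) \<in># queue s"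
    and min: "\<forall>(ob', k') \<in># queue s. k \<le> k'"
  shows "\<exists>s' \<sigma>'. alg_step N s s' \<and> alg_inv N s' k \<and> static \<sigma>' \<and> linked \<sigma>' s' k \<and>
    nreg \<sigma>' 9 = nreg \<sigma> 9 \<and> potential s' < potential s \<and>
    reach (40 * (potential s - potential s')) (node_prog, \<sigma>) (Skip, \<sigma>')"
proof -
  interpret alg_inv N s k\<^sub>0 by (rule inv)
  let ?s = "s\<lparr>queue := queue s - {#(Node z, k)#}\<rparr>"
  have z: "z \<in> nodes N" using queue_node[OF pop] by (auto simp: nodes_def)
  have "mark ?s z = k" if "z \<in> Vmax N \<or> \<not> node_done ?s z"
    using that queue_node[OF pop] undone_key[OF pop min] Vmin_Vmax by auto
  from node_prog_correct[OF assms(1,2) z assms(3) this] obtain \<sigma>' vs where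
    *: "distinct vs" "set vs = Succ N z" "static \<sigma>'" "nreg \<sigma>' 9 = nreg \<sigma> 9"
      "linked \<sigma>' (process_node N z vs ?s) k"
    and R: "reach (40 + (if z \<in> Vmax N \<or> \<not> node_done s z then 32 * card (Succ N z) else 0))
      (node_prog, \<sigma>) (Skip, \<sigma>')" by auto
  note P = process_node_inv[OF inv pop min *(1,2) refl]
  have "pop_min s (Node z) ?s" using pop min unfolding pop_min_def by blast
  hence "alg_step N s (process_node N z vs ?s)" using * by (intro alg_step.node)
  moreover have "reach (40 * (potential s - potential (process_node N z vs ?s)))
      (node_prog, \<sigma>) (Skip, \<sigma>')"
    by (rule reach_mono[OF R]) (use P in auto)
  ultimately show ?thesis using * P by (intro exI[of _ "process_node N z vs ?s"] exI[of _ \<sigma>']) auto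
qed

lemma list_node_step:
  assumes "static \<sigma>" "linked \<sigma> s k\<^sub>0" "nreg \<sigma> 8 = 0" "nreg \<sigma> 6 < length xs"
    and k: "k = lim N (xs ! nreg \<sigma> 6)"
    and inv: "alg_inv N s k\<^sub>0" and min: "\<forall>(ob', k') \<in># queue s. k \<le> k'"
  shows "\<exists>s' \<sigma>'. alg_step N s s' \<and> alg_inv N s' k \<and> static \<sigma>' \<and> linked \<sigma>' s' k \<and>
    nreg \<sigma>' 9 = nreg \<sigma> 9 \<and> potential s' < potential s \<and>
    reach (40 * (potential s - potential s') + 5) (list_node_prog, \<sigma>) (Skip, \<sigma>')"
proof -
  define \<sigma>1 where "\<sigma>1 = eff (block [NLoad 10 0 6, NInc 6]) \<sigma>"
  have R1: "reach 4 (block [NLoad 10 0 6, NInc 6], \<sigma>) (Skip, \<sigma>1)"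
    using reach_loop_free[of "block [NLoad 10 0 6, NInc 6]" \<sigma>]
    unfolding \<sigma>1_def by (simp del: block.simps eff_block)
  let ?x = "xs ! nreg \<sigma> 6"
  \<comment> \<open>With an empty stack the queue does not depend on the key parameter of
    \<open>linked\<close>, which can therefore advance to the key about to be extracted.\<close>
  have l: "linked \<sigma> s k" using linked_rekey assms(2,3) .
  hence q: "queue s = listed (nreg \<sigma> 6) (nreg \<sigma> 7) [] k"
    using assms(3) unfolding linked_def stacked_def by auto
  have "listed (nreg \<sigma> 6) (nreg \<sigma> 7) [] k = add_mset (Node ?x, k) (listed (Suc (nreg \<sigma> 6)) (nreg \<sigma> 7) [] k)"
    by (simp add: listed_def k Cons_nth_drop_Suc[OF assms(4), symmetric])
  hence pop: "(Node ?x, k) \<in># queue s"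
    and q1: "queue s - {#(Node ?x, k)#} = listed (Suc (nreg \<sigma> 6)) (nreg \<sigma> 7) [] k"
    by (simp_all add: q)
  have "static \<sigma>1" by (rule static_cong[OF assms(1)]) (auto simp: \<sigma>1_def)
  moreover have "linked \<sigma>1 (s\<lparr>queue := queue s - {#(Node ?x, k)#}\<rparr>) k"
    using l assms(3,4) unfolding q1 linked_def
    by (auto simp: \<sigma>1_def represents_def stacked_def intro!: exI[of _ "[]"])
  moreover have "nreg \<sigma>1 10 = code ?x"
    using assms(1,4) by (simp add: \<sigma>1_def static_def input_memory_def)
  ultimately obtain s' \<sigma>' where *: "alg_step N s s'" "alg_inv N s' k" "static \<sigma>'" "linked \<sigma>' s' k"
    "nreg \<sigma>' 9 = nreg \<sigma>1 9" "potential s' < potential s"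
    "reach (40 * (potential s - potential s')) (node_prog, \<sigma>1) (Skip, \<sigma>')"
    using node_step[OF _ _ _ inv pop min] by blast
  have "reach (4 + 40 * (potential s - potential s') + 1) (list_node_prog, \<sigma>) (Skip, \<sigma>')"
    unfolding list_node_prog_def by (rule reach_Seq2[OF R1 *(7)])
  thus ?thesis using * by (intro exI[of _ s'] exI[of _ \<sigma>']) (simp add: \<sigma>1_def add.commute)
qed

lemma edge_step:
  assumes "static \<sigma>" "linked \<sigma> s k\<^sub>0" "nreg \<sigma> 8 = 0" "nreg \<sigma> 7 < length es"
    and zy: "es ! nreg \<sigma> 7 = (z, y)" and k: "k = wt N z y"
    and inv: "alg_inv N s k\<^sub>0" and min: "\<forall>(ob', k') \<in># queue s. k \<le> k'"
  shows "\<exists>s' \<sigma>'. alg_step N s s' \<and> alg_inv N s' k \<and> static \<sigma>' \<and> linked \<sigma>' s' k \<and>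
    nreg \<sigma>' 9 = nreg \<sigma> 9 \<and> potential s' < potential s \<and>
    reach 29 (edge_prog, \<sigma>) (Skip, \<sigma>')"
proof -
  define \<sigma>1 where "\<sigma>1 = eff (block [NLoad 11 3 7, RLoad 0 1 7, NCopy 12 7, NInc 7]) \<sigma>"
  have l: "linked \<sigma> s k" using linked_rekey assms(2,3) .
  hence q: "queue s = listed (nreg \<sigma> 6) (nreg \<sigma> 7) [] k"
    using assms(3) unfolding linked_def stacked_def by auto
  have "listed (nreg \<sigma> 6) (nreg \<sigma> 7) [] k = add_mset (Edge z y, k) (listed (nreg \<sigma> 6) (Suc (nreg \<sigma> 7)) [] k)"
    by (simp add: listed_def k zy Cons_nth_drop_Suc[OF assms(4), symmetric])
  hence pop: "(Edge z y, k) \<in># queue s"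
    and q1: "queue s - {#(Edge z y, k)#} = listed (nreg \<sigma> 6) (Suc (nreg \<sigma> 7)) [] k"
    by (simp_all add: q)
  let ?s = "s\<lparr>queue := queue s - {#(Edge z y, k)#}\<rparr>"
  have s1: "static \<sigma>1" by (rule static_cong[OF assms(1)]) (auto simp: \<sigma>1_def)
  have l1: "linked \<sigma>1 ?s k"
    using l assms(3,4) unfolding q1 linked_def
    by (auto simp: \<sigma>1_def represents_def stacked_def intro!: exI[of _ "[]"])
  have "nreg \<sigma>1 12 < length es" "es ! nreg \<sigma>1 12 = (z, y)" "nreg \<sigma>1 11 = code y" "rreg \<sigma>1 0 = k"
    using assms(1,4) zy k by (simp_all add: \<sigma>1_def static_def input_memory_def)
  from settle_prog_correct[OF s1 l1 this] have *: "static (eff settle_prog \<sigma>1)"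
    "linked (eff settle_prog \<sigma>1) (settle z y k ?s) k" "nreg (eff settle_prog \<sigma>1) 9 = nreg \<sigma> 9"
    by (auto simp: \<sigma>1_def)
  have "eff edge_prog \<sigma> = eff settle_prog \<sigma>1" by (simp add: edge_prog_def \<sigma>1_def)
  with reach_loop_free[of edge_prog \<sigma>] have R: "reach 29 (edge_prog, \<sigma>) (Skip, eff settle_prog \<sigma>1)"
    by simp
  have "pop_min s (Edge z y) ?s" using pop min unfolding pop_min_def by blast
  hence "alg_step N s (settle z y k ?s)" unfolding k by (rule alg_step.edge)
  thus ?thesis using * R settle_edge_inv[OF inv pop min refl, folded k]
    by (intro exI[of _ "settle z y k ?s"] exI[of _ "eff settle_prog \<sigma>1"]) auto
qed

text \<open>The potential drops by at least 1, so raising the rate from 40 to 60 absorbs the choice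
  of the next object: at most 14 extra steps for a node, and at most 38 steps in all for an
  edge.\<close>

lemma main_step:
  assumes "static \<sigma>" "linked \<sigma> s k" and inv: "alg_inv N s k" and ne: "queue s \<noteq> {#}"
  shows "\<exists>s' \<sigma>' k'. alg_step N s s' \<and> alg_inv N s' k' \<and> static \<sigma>' \<and> linked \<sigma>' s' k' \<and>
    nreg \<sigma>' 9 = nreg \<sigma> 9 \<and> potential s' < potential s \<and>
    reach (60 * (potential s - potential s')) (main_body, \<sigma>) (Skip, \<sigma>')"
proof -
  have c: "nreg \<sigma> 4 = 0" "nreg \<sigma> 0 = length xs" "nreg \<sigma> 2 = length es"
    using assms(1) by (auto simp: static_def input_memory_def)
  obtain st where st: "stacked \<sigma> st" "queue s = listed (nreg \<sigma> 6) (nreg \<sigma> 7) st k"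
    using assms(2) unfolding linked_def by blast
  have stack: ?thesis if pos: "nreg \<sigma> 8 > 0"
  proof -
    define \<sigma>1 where "\<sigma>1 = eff (block [NDec 8, NLoad 10 13 8]) \<sigma>"
    have R1: "reach 4 (block [NDec 8, NLoad 10 13 8], \<sigma>) (Skip, \<sigma>1)"
      using reach_loop_free[of "block [NDec 8, NLoad 10 13 8]" \<sigma>]
      unfolding \<sigma>1_def by (simp del: block.simps eff_block)
    obtain st' z where st': "st = st' @ [z]"
      using pos st(1) by (cases st rule: rev_cases) (auto simp: stacked_def)
    hence pop: "(Node z, k) \<in># queue s"
      and q1: "queue s - {#(Node z, k)#} = listed (nreg \<sigma> 6) (nreg \<sigma> 7) st' k"
      using st(2) by (simp_all add: listed_push)
    have "stacked \<sigma>1 st'" using st(1) by (auto simp: \<sigma>1_def stacked_def st' nth_append)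
    hence "linked \<sigma>1 (s\<lparr>queue := queue s - {#(Node z, k)#}\<rparr>) k"
      using assms(2) unfolding q1 linked_def by (auto simp: \<sigma>1_def represents_def)
    moreover have "static \<sigma>1" by (rule static_cong[OF assms(1)]) (auto simp: \<sigma>1_def)
    moreover have "nreg \<sigma>1 10 = code z" using st(1) by (auto simp: \<sigma>1_def stacked_def st' nth_append)
    moreover have "\<forall>(ob', k') \<in># queue s. k \<le> k'" using alg_inv.k_le[OF inv] by blast
    ultimately obtain s' \<sigma>' where *: "alg_step N s s'" "alg_inv N s' k" "static \<sigma>'" "linked \<sigma>' s' k"
      "nreg \<sigma>' 9 = nreg \<sigma>1 9" "potential s' < potential s"
      "reach (40 * (potential s - potential s')) (node_prog, \<sigma>1) (Skip, \<sigma>')"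
      using node_step[OF _ _ _ inv pop] by blast
    have "reach (4 + 40 * (potential s - potential s') + 1 + 1) (main_body, \<sigma>) (Skip, \<sigma>')"
      unfolding main_body_def using pos c
      by - (rule reach_Cond_True, simp, rule reach_Seq2[OF R1 *(7)])
    hence "reach (60 * (potential s - potential s')) (main_body, \<sigma>) (Skip, \<sigma>')"
      by (rule reach_mono) (use *(6) in auto)
    thus ?thesis using * by (intro exI[of _ s'] exI[of _ \<sigma>'] exI[of _ k]) (simp add: \<sigma>1_def)
  qed
  have empty: ?thesis if e: "nreg \<sigma> 8 = 0"
  proof -
    have q: "queue s = listed (nreg \<sigma> 6) (nreg \<sigma> 7) [] k"
      using e st unfolding stacked_def by auto
    note mn = listed_min[of _ _ "nreg \<sigma> 6" "nreg \<sigma> 7" k, folded q]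
    obtain z y where zy: "es ! nreg \<sigma> 7 = (z, y)" by fastforce
    define \<sigma>1 where "\<sigma>1 = eff (block [RLoad 0 0 6, RLoad 1 1 7]) \<sigma>"
    have R1: "reach 4 (block [RLoad 0 0 6, RLoad 1 1 7], \<sigma>) (Skip, \<sigma>1)"
      using reach_loop_free[of "block [RLoad 0 0 6, RLoad 1 1 7]" \<sigma>]
      unfolding \<sigma>1_def by (simp del: block.simps eff_block)
    have s1: "static \<sigma>1" by (rule static_cong[OF assms(1)]) (auto simp: \<sigma>1_def)
    have l1: "linked \<sigma>1 s k" by (rule linked_cong[OF assms(2)]) (auto simp: \<sigma>1_def)
    have n1: "nreg \<sigma>1 i = nreg \<sigma> i" for i by (simp add: \<sigma>1_def)
    consider (both) "nreg \<sigma> 6 < length xs" "nreg \<sigma> 7 < length es"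
      | (min) "nreg \<sigma> 6 < length xs" "\<not> nreg \<sigma> 7 < length es"
      | (edge) "\<not> nreg \<sigma> 6 < length xs" "nreg \<sigma> 7 < length es"
      | (none) "\<not> nreg \<sigma> 6 < length xs" "\<not> nreg \<sigma> 7 < length es" by blast
    thus ?thesis
    proof cases
      case both
      have r: "rreg \<sigma>1 0 = lim N (xs ! nreg \<sigma> 6)" "rreg \<sigma>1 1 = wt N z y"
        using assms(1) both zy by (auto simp: \<sigma>1_def static_def input_memory_def)
      show ?thesis
      proof (cases "wt N z y < lim N (xs ! nreg \<sigma> 6)")
        case True
        hence "\<forall>(ob', k') \<in># queue s. wt N z y \<le> k'" using mn zy by fastforce
        from edge_step[OF s1 l1, unfolded n1, OF e both(2) zy refl inv this] obtain s' \<sigma>' where *: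
          "alg_step N s s'" "alg_inv N s' (wt N z y)" "static \<sigma>'" "linked \<sigma>' s' (wt N z y)"
          "nreg \<sigma>' 9 = nreg \<sigma> 9" "potential s' < potential s" "reach 29 (edge_prog, \<sigma>1) (Skip, \<sigma>')"
          by blast
        have "reach (4 + (29 + 1) + 1 + 1 + 1 + 1) (main_body, \<sigma>) (Skip, \<sigma>')"
          unfolding main_body_def using e c both r True
          by - (rule reach_Cond_False, simp, rule reach_Cond_True, simp, rule reach_Cond_True, simp,
              rule reach_Seq2[OF R1 reach_Cond_True], simp, rule *(7))
        hence "reach (60 * (potential s - potential s')) (main_body, \<sigma>) (Skip, \<sigma>')"
          by (rule reach_mono) (use *(6) in auto)
        thus ?thesis using * by blast
      next
        case False
        hence "\<forall>(ob', k') \<in># queue s. lim N (xs ! nreg \<sigma> 6) \<le> k'" using mn zy by fastforce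
        from list_node_step[OF s1 l1, unfolded n1, OF e both(1) refl inv this] obtain s' \<sigma>' where *:
          "alg_step N s s'" "alg_inv N s' (lim N (xs ! nreg \<sigma> 6))" "static \<sigma>'"
          "linked \<sigma>' s' (lim N (xs ! nreg \<sigma> 6))"
          "nreg \<sigma>' 9 = nreg \<sigma> 9" "potential s' < potential s"
          "reach (40 * (potential s - potential s') + 5) (list_node_prog, \<sigma>1) (Skip, \<sigma>')"
          by blast
        have "reach (4 + (40 * (potential s - potential s') + 5 + 1) + 1 + 1 + 1 + 1) (main_body, \<sigma>) (Skip, \<sigma>')"
          unfolding main_body_def using e c both r False
          by - (rule reach_Cond_False, simp, rule reach_Cond_True, simp, rule reach_Cond_True, simp,
              rule reach_Seq2[OF R1 reach_Cond_False], simp, rule *(7))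
        hence "reach (60 * (potential s - potential s')) (main_body, \<sigma>) (Skip, \<sigma>')"
          by (rule reach_mono) (use *(6) in auto)
        thus ?thesis using * by blast
      qed
    next
      case min
      hence "\<forall>(ob', k') \<in># queue s. lim N (xs ! nreg \<sigma> 6) \<le> k'" using mn by fastforce
      from list_node_step[OF assms(1,2) e min(1) refl inv this] obtain s' \<sigma>' where *:
        "alg_step N s s'" "alg_inv N s' (lim N (xs ! nreg \<sigma> 6))" "static \<sigma>'"
        "linked \<sigma>' s' (lim N (xs ! nreg \<sigma> 6))"
        "nreg \<sigma>' 9 = nreg \<sigma> 9" "potential s' < potential s"
        "reach (40 * (potential s - potential s') + 5) (list_node_prog, \<sigma>) (Skip, \<sigma>')"
        by blast
      have "reach (40 * (potential s - potential s') + 5 + 1 + 1 + 1) (main_body, \<sigma>) (Skip, \<sigma>')"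
        unfolding main_body_def using e c min
        by - (rule reach_Cond_False, simp, rule reach_Cond_True, simp, rule reach_Cond_False, simp, rule *(7))
      hence "reach (60 * (potential s - potential s')) (main_body, \<sigma>) (Skip, \<sigma>')"
        by (rule reach_mono) (use *(6) in auto)
      thus ?thesis using * by blast
    next
      case edge
      hence "\<forall>(ob', k') \<in># queue s. wt N z y \<le> k'" using mn zy by fastforce
      from edge_step[OF assms(1,2) e edge(2) zy refl inv this] obtain s' \<sigma>' where *:
        "alg_step N s s'" "alg_inv N s' (wt N z y)" "static \<sigma>'" "linked \<sigma>' s' (wt N z y)"
        "nreg \<sigma>' 9 = nreg \<sigma> 9" "potential s' < potential s" "reach 29 (edge_prog, \<sigma>) (Skip, \<sigma>')"
        by blast
      have "reach (29 + 1 + 1 + 1) (main_body, \<sigma>) (Skip, \<sigma>')"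
        unfolding main_body_def using e c edge
        by - (rule reach_Cond_False, simp, rule reach_Cond_False, simp, rule reach_Cond_True, simp, rule *(7))
      hence "reach (60 * (potential s - potential s')) (main_body, \<sigma>) (Skip, \<sigma>')"
        by (rule reach_mono) (use *(6) in auto)
      thus ?thesis using * by blast
    next
      case none
      thus ?thesis using ne q by (simp add: listed_def)
    qed
  qed
  show ?thesis using stack empty by blast
qed

text \<open>The machine notices the empty queue only in one further iteration, which clears register
  9 and writes no array. This takes at most 7 steps, and leaving the loop takes 1.\<close>

lemma main_end:
  assumes "static \<sigma>" "linked \<sigma> s k" "queue s = {#}" "nreg \<sigma> 9 = 1"
  shows "\<exists>\<sigma>'. reach 8 (main_loop, \<sigma>) (Skip, \<sigma>') \<and> represents N code es 3 6 7 8 \<sigma>' s"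
proof -
  have c: "nreg \<sigma> 4 = 0" "nreg \<sigma> 5 = 1" "nreg \<sigma> 0 = length xs" "nreg \<sigma> 2 = length es"
    using assms(1) by (auto simp: static_def input_memory_def)
  have e: "nreg \<sigma> 8 = 0" "nreg \<sigma> 6 = length xs" "nreg \<sigma> 7 = length es"
    using assms(2,3) unfolding linked_def listed_def stacked_def by auto
  define \<sigma>' where "\<sigma>' = eff (block [NConst 9 0]) \<sigma>"
  have "reach 2 (block [NConst 9 0], \<sigma>) (Skip, \<sigma>')"
    using reach_loop_free[of "block [NConst 9 0]" \<sigma>]
    unfolding \<sigma>'_def by (simp del: block.simps eff_block)
  note R = this
  have "reach (2 + 1 + 1 + 1) (main_body, \<sigma>) (Skip, \<sigma>')"
    unfolding main_body_def using e c
    by - (rule reach_Cond_False, simp, rule reach_Cond_False, simp, rule reach_Cond_False, simp, rule R)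
  from reach_While_iter[OF _ this, of "NEq 9 5"]
  have "reach (2 + 1 + 1 + 1 + 2) (main_loop, \<sigma>) (main_loop, \<sigma>')"
    using c assms(4) by (simp add: main_loop_def)
  moreover have "reach 1 (main_loop, \<sigma>') (Skip, \<sigma>')"
    unfolding main_loop_def by (rule reach_While_exit) (use c in \<open>simp add: \<sigma>'_def\<close>)
  ultimately have "reach 8 (main_loop, \<sigma>) (Skip, \<sigma>')" using reach_trans by fastforce
  moreover have "represents N code es 3 6 7 8 \<sigma>' s"
    using assms(2) by (simp add: linked_def represents_def \<sigma>'_def)
  ultimately show ?thesis by blast
qed

text \<open>A round costs at most 60 per unit of potential lost and 2 for the loop itself; as at
  least one unit is lost, the rate is 62.\<close>

lemma main_run:
  assumes "static \<sigma>" "linked \<sigma> s k" "alg_inv N s k" "nreg \<sigma> 9 = 1"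
  shows "\<exists>n S t T \<sigma>'. S 0 = s \<and> (\<forall>i < n. alg_step N (S i) (S (Suc i))) \<and> queue (S n) = {#} \<and>
    (\<forall>i < n. t i < t (Suc i)) \<and> t 0 = 0 \<and> t n \<le> 62 * potential s \<and> T \<le> 8 \<and>
    (\<forall>i \<le> n. represents N code es 3 6 7 8 (snd ((small_step ^^ t i) (main_loop, \<sigma>))) (S i)) \<and>
    (small_step ^^ (t n + T)) (main_loop, \<sigma>) = (Skip, \<sigma>') \<and> represents N code es 3 6 7 8 \<sigma>' (S n)"
  using assms
proof (induction "potential s" arbitrary: \<sigma> s k rule: less_induct)
  case less
  have rep: "represents N code es 3 6 7 8 \<sigma> s" using less.prems(2) by (simp add: linked_def)
  show ?case
  proof (cases "queue s = {#}")
    case True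
    from main_end[OF less.prems(1,2) this less.prems(4)] obtain \<sigma>' T where
      "T \<le> 8" "(small_step ^^ T) (main_loop, \<sigma>) = (Skip, \<sigma>')" "represents N code es 3 6 7 8 \<sigma>' s"
      unfolding reach_def by blast
    thus ?thesis using True rep
      by (intro exI[of _ 0] exI[of _ "\<lambda>_. s"] exI[of _ "\<lambda>_. 0"] exI[of _ T] exI[of _ \<sigma>']) simp
  next
    case False
    from main_step[OF less.prems(1-3) this] obtain s' \<sigma>1 k' where
      *: "alg_step N s s'" "alg_inv N s' k'" "static \<sigma>1" "linked \<sigma>1 s' k'" "nreg \<sigma>1 9 = 1"
        "potential s' < potential s"
      and R: "reach (60 * (potential s - potential s')) (main_body, \<sigma>) (Skip, \<sigma>1)"
      using less.prems(4) by auto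
    have "holds (NEq 9 5) \<sigma>" using less.prems(1,4) by (simp add: static_def)
    from reach_While[OF this R] obtain u where u: "0 < u" "u \<le> 60 * (potential s - potential s') + 2"
      "(small_step ^^ u) (main_loop, \<sigma>) = (main_loop, \<sigma>1)" unfolding main_loop_def by blast
    have shift: "(small_step ^^ (u + j)) (main_loop, \<sigma>) = (small_step ^^ j) (main_loop, \<sigma>1)" for j
      using u(3) by (simp add: add.commute[of u] funpow_add)
    from less.hyps[OF *(6,3,4,2,5)] obtain n S t T \<sigma>' where
      IH: "S 0 = s'" "\<forall>i < n. alg_step N (S i) (S (Suc i))" "queue (S n) = {#}"
      "\<forall>i < n. t i < t (Suc i)" "t 0 = 0" "t n \<le> 62 * potential s'" "T \<le> 8"
      "\<forall>i \<le> n. represents N code es 3 6 7 8 (snd ((small_step ^^ t i) (main_loop, \<sigma>1))) (S i)"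
      "(small_step ^^ (t n + T)) (main_loop, \<sigma>1) = (Skip, \<sigma>')" "represents N code es 3 6 7 8 \<sigma>' (S n)"
      by blast
    \<comment> \<open>The run from \<open>s'\<close> is prefixed with \<open>s\<close> and delayed
      by \<open>u\<close>; since \<open>u\<close> is positive, the times still increase
      strictly.\<close>
    define S' where "S' = case_nat s S"
    define t' where "t' = case_nat 0 (\<lambda>i. u + t i)"
    have simps: "S' 0 = s" "S' (Suc i) = S i" "t' 0 = 0" "t' (Suc i) = u + t i" for i
      by (simp_all add: S'_def t'_def)
    have "\<forall>i < Suc n. alg_step N (S' i) (S' (Suc i))" "\<forall>i < Suc n. t' i < t' (Suc i)"
      using *(1) IH u(1) by (auto simp: All_less_Suc2 simps)
    moreover have "represents N code es 3 6 7 8 (snd ((small_step ^^ t' i) (main_loop, \<sigma>))) (S' i)"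
      if "i \<le> Suc n" for i
      using that rep IH(8) by (cases i) (simp_all add: simps shift)
    moreover have "t' (Suc n) \<le> 62 * potential s" using IH(6) u(2) *(6) by (simp add: simps)
    moreover have "(small_step ^^ (t' (Suc n) + T)) (main_loop, \<sigma>) = (Skip, \<sigma>')"
      using IH(9) by (simp add: simps shift add.assoc del: funpow.simps)
    ultimately show ?thesis using IH simps
      by (intro exI[of _ "Suc n"] exI[of _ S'] exI[of _ t'] exI[of _ T] exI[of _ \<sigma>']) simp
  qed
qed

section \<open>Initialization of the memory\<close>

definition based :: "mem \<Rightarrow> bool" where
  "based \<sigma> \<longleftrightarrow> input_memory N code xs ys es fs \<sigma> \<and> nreg \<sigma> 4 = 0 \<and> nreg \<sigma> 5 = 1 \<and>
     nreg \<sigma> 6 = 0 \<and> nreg \<sigma> 7 = 0 \<and> nreg \<sigma> 9 = 1 \<and> rreg \<sigma> 0 = 0"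

lemma based_cong:
  assumes "based \<sigma>" "\<And>i. i \<in> {0, 1, 2, 3, 4, 5, 6, 7, 9} \<Longrightarrow> nreg \<sigma>' i = nreg \<sigma> i" "rreg \<sigma>' 0 = rreg \<sigma> 0"
    "\<And>i. i < 6 \<Longrightarrow> narr \<sigma>' i = narr \<sigma> i" "\<And>i. i < 3 \<Longrightarrow> rarr \<sigma>' i = rarr \<sigma> i"
  shows "based \<sigma>'"
  using assms unfolding based_def input_memory_def by simp

definition min_ok :: "mem \<Rightarrow> 'v \<Rightarrow> bool" where
  "min_ok \<sigma> x \<longleftrightarrow> rarr \<sigma> 3 (code x) = lim N x \<and> narr \<sigma> 6 (code x) = 0 \<and> narr \<sigma> 9 (code x) = 0"

definition max_ok :: "mem \<Rightarrow> 'v \<Rightarrow> bool" where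
  "max_ok \<sigma> y \<longleftrightarrow> rarr \<sigma> 3 (code y) = 0 \<and> narr \<sigma> 9 (code y) = 1"

definition indegree :: "nat \<Rightarrow> 'v \<Rightarrow> nat" where
  "indegree j y = length (filter (\<lambda>e. snd e = y) (take j es))"

lemma indegree_0 [simp]: "indegree 0 y = 0"
  by (simp add: indegree_def)

lemma indegree_Suc:
  "j < length es \<Longrightarrow> indegree (Suc j) y = (if snd (es ! j) = y then Suc (indegree j y) else indegree j y)"
  by (simp add: indegree_def take_Suc_conv_app_nth)

lemma indegree_all:
  assumes "y \<in> Vmax N"
  shows "indegree (length es) y = card (Pred N y)"
proof -
  have "indegree (length es) y = card (set (filter (\<lambda>e. snd e = y) es))"
    unfolding indegree_def using distinct_card[OF distinct_filter[OF es(1)], of "\<lambda>e. snd e = y"] by simp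
  also have "set (filter (\<lambda>e. snd e = y) es) = (\<lambda>z. (z, y)) ` Pred N y"
    using assms by (auto simp: set_es Pred_max)
  finally show ?thesis by (simp add: card_image inj_on_def)
qed

text \<open>Nothing is known about memory outside the input, so each phase speaks only of cells
  already written. The stack height, register 8, is kept out of \<open>based\<close> because the
  last phase pushes.\<close>

definition phase1 :: "nat \<Rightarrow> mem \<Rightarrow> bool" where
  "phase1 j \<sigma> \<longleftrightarrow> based \<sigma> \<and> nreg \<sigma> 8 = 0 \<and> nreg \<sigma> 12 = j \<and>
     (\<forall>x \<in> set (take j xs). min_ok \<sigma> x \<and> narr \<sigma> 10 (code x) = 0)"

definition phase2 :: "nat \<Rightarrow> mem \<Rightarrow> bool" where
  "phase2 j \<sigma> \<longleftrightarrow> based \<sigma> \<and> nreg \<sigma> 8 = 0 \<and> nreg \<sigma> 12 = j \<and>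
     (\<forall>x \<in> Vmin N. min_ok \<sigma> x \<and> narr \<sigma> 10 (code x) = 0) \<and>
     (\<forall>y \<in> set (take j ys). max_ok \<sigma> y \<and> narr \<sigma> 8 (code y) = 0 \<and> narr \<sigma> 14 (code y) = 0)"

definition phase3 :: "nat \<Rightarrow> mem \<Rightarrow> bool" where
  "phase3 j \<sigma> \<longleftrightarrow> based \<sigma> \<and> nreg \<sigma> 8 = 0 \<and> nreg \<sigma> 12 = j \<and>
     (\<forall>x \<in> Vmin N. min_ok \<sigma> x \<and> chain (narr \<sigma> 11) (narr \<sigma> 10 (code x)) (out_edges es j x)) \<and>
     (\<forall>y \<in> Vmax N. max_ok \<sigma> y \<and> narr \<sigma> 8 (code y) = indegree j y \<and> narr \<sigma> 14 (code y) = 0) \<and>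
     (\<forall>i < j. narr \<sigma> 7 i = 0)"

definition phase4 :: "nat \<Rightarrow> mem \<Rightarrow> bool" where
  "phase4 j \<sigma> \<longleftrightarrow> based \<sigma> \<and> nreg \<sigma> 8 = 0 \<and> nreg \<sigma> 12 = j \<and>
     (\<forall>x \<in> Vmin N. min_ok \<sigma> x \<and>
        chain (narr \<sigma> 11) (narr \<sigma> 10 (code x)) (out_edges es (length es) x)) \<and>
     (\<forall>y \<in> Vmax N. max_ok \<sigma> y \<and> narr \<sigma> 8 (code y) = card (Pred N y) \<and>
        chain (narr \<sigma> 12) (narr \<sigma> 14 (code y)) (out_edges fs j y)) \<and>
     (\<forall>i < length es. narr \<sigma> 7 i = 0)"

definition phase5 :: "nat \<Rightarrow> mem \<Rightarrow> bool" where
  "phase5 j \<sigma> \<longleftrightarrow> based \<sigma> \<and> nreg \<sigma> 12 = j \<and>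
     (\<forall>x \<in> Vmin N. min_ok \<sigma> x \<and>
        chain (narr \<sigma> 11) (narr \<sigma> 10 (code x)) (out_edges es (length es) x)) \<and>
     (\<forall>y \<in> Vmax N. max_ok \<sigma> y \<and> narr \<sigma> 8 (code y) = card (Pred N y) \<and>
        chain (narr \<sigma> 12) (narr \<sigma> 14 (code y)) (out_edges fs (length fs) y)) \<and>
     (\<forall>i < length es. narr \<sigma> 7 i = 0) \<and>
     stacked \<sigma> (filter (\<lambda>y. card (Pred N y) = 0) (take j ys))"

lemma based_regs:
  assumes "based \<sigma>"
  shows "nreg \<sigma> 0 = length xs" "nreg \<sigma> 1 = length ys" "nreg \<sigma> 2 = length es" "nreg \<sigma> 3 = length fs"
    "nreg \<sigma> 4 = 0" "nreg \<sigma> 5 = 1" "rreg \<sigma> 0 = 0"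
  using assms by (auto simp: based_def input_memory_def)

lemma phase1_step:
  assumes "phase1 j \<sigma>" "j < length xs"
  shows "phase1 (Suc j) (eff init_min \<sigma>)"
proof -
  have b: "based \<sigma>" and j: "nreg \<sigma> 12 = j" using assms(1) by (auto simp: phase1_def)
  have "narr \<sigma> 0 j = code (xs ! j)" "rarr \<sigma> 0 j = lim N (xs ! j)"
    using b assms(2) by (auto simp: based_def input_memory_def)
  moreover have "based (eff init_min \<sigma>)" by (rule based_cong[OF b]) (auto simp: init_min_def)
  moreover have "code x = code (xs ! j) \<longleftrightarrow> x = xs ! j" if "x \<in> set (take j xs)" for x
    using that xs_nth[OF assms(2)] in_set_takeD[OF that] code_inj in_nodes xs(2) by blast
  ultimately show ?thesis using assms based_regs[OF b]
    unfolding phase1_def min_ok_def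
    by (auto simp: init_min_def take_Suc_conv_app_nth)
qed

lemma phase2_step:
  assumes "phase2 j \<sigma>" "j < length ys"
  shows "phase2 (Suc j) (eff init_max \<sigma>)"
proof -
  have b: "based \<sigma>" and j: "nreg \<sigma> 12 = j" using assms(1) by (auto simp: phase2_def)
  have "narr \<sigma> 1 j = code (ys ! j)"
    using b assms(2) by (auto simp: based_def input_memory_def)
  moreover have "based (eff init_max \<sigma>)" by (rule based_cong[OF b]) (auto simp: init_max_def)
  \<comment> \<open>Min-nodes and max-nodes share the arrays 3 and 9, so the stores for a max-node
    must miss the cells of all min-nodes.\<close>
  moreover have "code x \<noteq> code (ys ! j)" if "x \<in> Vmin N" for x
    using that ys_nth[OF assms(2)] code_inj in_nodes Vmin_Vmax by metis
  ultimately show ?thesis using assms based_regs[OF b]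
    unfolding phase2_def min_ok_def max_ok_def
    by (auto simp: init_max_def take_Suc_conv_app_nth)
qed

lemma phase3_step:
  assumes "phase3 j \<sigma>" "j < length es"
  shows "phase3 (Suc j) (eff init_min_edges \<sigma>)"
proof -
  have b: "based \<sigma>" and j: "nreg \<sigma> 12 = j" using assms(1) by (auto simp: phase3_def)
  have i: "narr \<sigma> 2 j = code (fst (es ! j))" "narr \<sigma> 3 j = code (snd (es ! j))"
    using b assms(2) by (auto simp: based_def input_memory_def)
  have b': "based (eff init_min_edges \<sigma>)"
    by (rule based_cong[OF b]) (auto simp: init_min_edges_def)
  have cx: "code x = code (fst (es ! j)) \<longleftrightarrow> x = fst (es ! j)" if "x \<in> Vmin N" for x
    using that es_nth[OF assms(2)] code_inj in_nodes by metis
  have cy: "code y = code (snd (es ! j)) \<longleftrightarrow> y = snd (es ! j)" if "y \<in> Vmax N" for y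
    using that es_nth[OF assms(2)] code_inj in_nodes by metis
  \<comment> \<open>Link cell \<open>j\<close> is on no list yet, so writing it breaks none.\<close>
  have nj: "j \<notin> set (out_edges es j x)" for x by (simp add: set_out_edges)
  show ?thesis using assms b' based_regs[OF b] i j es_nth[OF assms(2)]
    unfolding phase3_def min_ok_def max_ok_def
    by (auto simp: init_min_edges_def out_edges_Suc indegree_Suc cx cy chain_fun_upd[OF nj] less_Suc_eq)
qed

lemma phase4_step:
  assumes "phase4 j \<sigma>" "j < length fs"
  shows "phase4 (Suc j) (eff init_max_edges \<sigma>)"
proof -
  have b: "based \<sigma>" and j: "nreg \<sigma> 12 = j" using assms(1) by (auto simp: phase4_def)
  have i: "narr \<sigma> 4 j = code (fst (fs ! j))"
    using b assms(2) by (auto simp: based_def input_memory_def)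
  have b': "based (eff init_max_edges \<sigma>)"
    by (rule based_cong[OF b]) (auto simp: init_max_edges_def)
  have cy: "code y = code (fst (fs ! j)) \<longleftrightarrow> y = fst (fs ! j)" if "y \<in> Vmax N" for y
    using that fs_nth[OF assms(2)] code_inj in_nodes by metis
  have nj: "j \<notin> set (out_edges fs j y)" for y by (simp add: set_out_edges)
  show ?thesis using assms b' based_regs[OF b] i j fs_nth[OF assms(2)]
    unfolding phase4_def min_ok_def max_ok_def
    by (auto simp: init_max_edges_def out_edges_Suc cy chain_fun_upd[OF nj])
qed

lemma phase5_step:
  assumes "phase5 j \<sigma>" "j < length ys"
  shows "phase5 (Suc j) (eff init_stack \<sigma>)"
proof -
  have b: "based \<sigma>" and j: "nreg \<sigma> 12 = j"
    and st: "stacked \<sigma> (filter (\<lambda>y. card (Pred N y) = 0) (take j ys))"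
    using assms(1) by (auto simp: phase5_def)
  let ?y = "ys ! j"
  have i: "narr \<sigma> 1 j = code ?y"
    using b assms(2) by (auto simp: based_def input_memory_def)
  have y: "?y \<in> Vmax N" "?y \<in> nodes N" using ys_nth[OF assms(2)] by auto
  hence c: "narr \<sigma> 8 (code ?y) = card (Pred N ?y)" using assms(1) by (simp add: phase5_def)
  have b': "based (eff init_stack \<sigma>)"
    by (rule based_cong[OF b]) (auto simp: init_stack_def)
  have "stacked (eff init_stack \<sigma>) (filter (\<lambda>y. card (Pred N y) = 0) (take (Suc j) ys))"
  proof (cases "card (Pred N ?y) = 0")
    case True
    have "stacked (eff init_stack \<sigma>) (filter (\<lambda>y. card (Pred N y) = 0) (take j ys) @ [?y])"
      by (rule stacked_push[OF st y(2)])
        (use True c i j based_regs[OF b] in \<open>simp_all add: init_stack_def del: card_0_eq\<close>)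
    thus ?thesis using True by (simp add: take_Suc_conv_app_nth assms(2))
  next
    case False
    hence "filter (\<lambda>y. card (Pred N y) = 0) (take (Suc j) ys) = filter (\<lambda>y. card (Pred N y) = 0) (take j ys)"
      by (simp add: take_Suc_conv_app_nth assms(2))
    moreover have "nreg (eff init_stack \<sigma>) 8 = nreg \<sigma> 8" "narr (eff init_stack \<sigma>) 13 = narr \<sigma> 13"
      using False c i j based_regs[OF b] by (simp_all add: init_stack_def del: card_0_eq)
    ultimately show ?thesis using st by (simp add: stacked_def)
  qed
  moreover have "narr (eff init_stack \<sigma>) i = narr \<sigma> i" if "i \<noteq> 13" for i
    using that by (simp add: init_stack_def)
  moreover have "rarr (eff init_stack \<sigma>) = rarr \<sigma>" "nreg (eff init_stack \<sigma>) 12 = Suc j"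
    using j by (simp_all add: init_stack_def)
  ultimately show ?thesis using assms(1) b' unfolding phase5_def min_ok_def max_ok_def by simp
qed

lemma init_prog_correct:
  assumes "input_memory N code xs ys es fs \<sigma>"
  shows "\<exists>\<sigma>'. reach (40 * (length xs + length ys + length es + length fs) + 40) (init_prog, \<sigma>) (Skip, \<sigma>') \<and>
    static \<sigma>' \<and> linked \<sigma>' (init_state N) 0 \<and> nreg \<sigma>' 9 = 1"
proof -
  let ?b = "block [NConst 4 0, NConst 5 1, NConst 6 0, NConst 7 0, NConst 8 0, NConst 9 1, RZero 0]"
  define \<sigma>0 where "\<sigma>0 = eff ?b \<sigma>"
  have R0: "reach 14 (?b, \<sigma>) (Skip, \<sigma>0)"
    using reach_loop_free[of ?b \<sigma>] unfolding \<sigma>0_def by (simp del: block.simps eff_block)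
  \<comment> \<open>The 4 extra steps are 2 for resetting the counter, 1 for the \<open>Seq\<close>
    and 1 for leaving the loop.\<close>
  have loop: "\<exists>\<sigma>'. reach ((dur p + 2) * n + 4) (for_all m p, \<sigma>) (Skip, \<sigma>') \<and> I n \<sigma>'"
    if p: "loop_free p" and I0: "I 0 (\<sigma>\<lparr>nreg := (nreg \<sigma>)(12 := 0)\<rparr>)"
      and m: "\<And>j \<sigma>. I j \<sigma> \<Longrightarrow> nreg \<sigma> 12 = j \<and> nreg \<sigma> m = n"
      and st: "\<And>j \<sigma>. I j \<sigma> \<Longrightarrow> j < n \<Longrightarrow> I (Suc j) (eff p \<sigma>)" for p n m I \<sigma>
  proof -
    have R: "reach 2 (block [NConst 12 0], \<sigma>) (Skip, \<sigma>\<lparr>nreg := (nreg \<sigma>)(12 := 0)\<rparr>)"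
      using reach_loop_free[of "block [NConst 12 0]" \<sigma>] by (simp del: block.simps)
    from reach_For[of p I "\<sigma>\<lparr>nreg := (nreg \<sigma>)(12 := 0)\<rparr>" 12 m n, OF p I0 m st]
    obtain \<sigma>' where R': "reach ((dur p + 2) * n + 1) (While (NLess 12 m) p, \<sigma>\<lparr>nreg := (nreg \<sigma>)(12 := 0)\<rparr>)
      (Skip, \<sigma>')" "I n \<sigma>'" by blast
    have "reach ((dur p + 2) * n + 4) (for_all m p, \<sigma>) (Skip, \<sigma>')"
      unfolding for_all_def by (rule reach_mono[OF reach_Seq2[OF R R'(1)]]) simp
    thus ?thesis using R'(2) by blast
  qed
  have b12: "based (\<sigma>\<lparr>nreg := (nreg \<sigma>)(12 := 0)\<rparr>)" if "based \<sigma>" for \<sigma>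
    by (rule based_cong[OF that]) auto
  have "based \<sigma>0" "nreg \<sigma>0 8 = 0" using assms by (auto simp: \<sigma>0_def based_def input_memory_def)
  hence "phase1 0 (\<sigma>0\<lparr>nreg := (nreg \<sigma>0)(12 := 0)\<rparr>)" using b12 by (simp add: phase1_def)
  from loop[of init_min phase1 \<sigma>0 0 "length xs", OF _ this _ phase1_step] obtain \<sigma>1 where
    R1: "reach (16 * length xs + 4) (for_all 0 init_min, \<sigma>0) (Skip, \<sigma>1)" "phase1 (length xs) \<sigma>1"
    by (auto simp: phase1_def based_regs)
  have "phase2 0 (\<sigma>1\<lparr>nreg := (nreg \<sigma>1)(12 := 0)\<rparr>)"
    using R1(2) b12 by (simp add: phase1_def phase2_def xs min_ok_def)
  from loop[of init_max phase2 \<sigma>1 1 "length ys", OF _ this _ phase2_step] obtain \<sigma>2 where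
    R2: "reach (14 * length ys + 4) (for_all 1 init_max, \<sigma>1) (Skip, \<sigma>2)" "phase2 (length ys) \<sigma>2"
    by (auto simp: phase2_def based_regs simp del: One_nat_def)
  have "phase3 0 (\<sigma>2\<lparr>nreg := (nreg \<sigma>2)(12 := 0)\<rparr>)"
    using R2(2) b12 by (simp add: phase2_def phase3_def ys min_ok_def max_ok_def)
  from loop[of init_min_edges phase3 \<sigma>2 2 "length es", OF _ this _ phase3_step] obtain \<sigma>3 where
    R3: "reach (22 * length es + 4) (for_all 2 init_min_edges, \<sigma>2) (Skip, \<sigma>3)" "phase3 (length es) \<sigma>3"
    by (auto simp: phase3_def based_regs)
  have "phase4 0 (\<sigma>3\<lparr>nreg := (nreg \<sigma>3)(12 := 0)\<rparr>)"
    using R3(2) b12 by (simp add: phase3_def phase4_def indegree_all min_ok_def max_ok_def)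
  from loop[of init_max_edges phase4 \<sigma>3 3 "length fs", OF _ this _ phase4_step] obtain \<sigma>4 where
    R4: "reach (12 * length fs + 4) (for_all 3 init_max_edges, \<sigma>3) (Skip, \<sigma>4)" "phase4 (length fs) \<sigma>4"
    by (auto simp: phase4_def based_regs)
  have "phase5 0 (\<sigma>4\<lparr>nreg := (nreg \<sigma>4)(12 := 0)\<rparr>)"
    using R4(2) b12 by (simp add: phase4_def phase5_def stacked_def min_ok_def max_ok_def)
  from loop[of init_stack phase5 \<sigma>4 1 "length ys", OF _ this _ phase5_step] obtain \<sigma>5 where
    R5: "reach (15 * length ys + 4) (for_all 1 init_stack, \<sigma>4) (Skip, \<sigma>5)" "phase5 (length ys) \<sigma>5"
    by (auto simp: phase5_def based_regs simp del: One_nat_def)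
  \<comment> \<open>The rate 40 covers the 14 + 15 steps that two passes spend on a max-node, and
    the fixed part is 14 + 5 * 4 + 5 = 39.\<close>
  have "reach (40 * (length xs + length ys + length es + length fs) + 40) (init_prog, \<sigma>) (Skip, \<sigma>5)"
    unfolding init_prog_def
    by (rule reach_mono[OF reach_Seq2[OF R0 reach_Seq2[OF R1(1) reach_Seq2[OF R2(1)
        reach_Seq2[OF R3(1) reach_Seq2[OF R4(1) R5(1)]]]]]]) simp
  moreover have "static \<sigma>5"
    using R5(2) Vmin_Vmax unfolding static_def phase5_def based_def min_ok_def max_ok_def nodes_def by auto
  moreover have "linked \<sigma>5 (init_state N) 0"
  proof -
    let ?st = "filter (\<lambda>y. card (Pred N y) = 0) ys"
    have "queue (init_state N) = listed 0 0 ?st 0"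
    proof -
      have "mset_set (Vmin N) = mset xs" using xs mset_set_set by metis
      moreover have "mset_set {y \<in> Vmax N. card (Pred N y) = 0} = mset ?st"
        using mset_set_set[of ?st] ys by (simp del: card_0_eq)
      moreover have "{(z, y) \<in> Vmin N \<times> Vmax N. wt N z y > 0} = set es" by (auto simp: set_es)
      hence "mset_set {(z, y) \<in> Vmin N \<times> Vmax N. wt N z y > 0} = mset es"
        using mset_set_set[OF es(1)] by simp
      ultimately show ?thesis unfolding init_state_def listed_def
        by (simp add: ac_simps del: card_0_eq)
    qed
    moreover have "nreg \<sigma>5 6 = 0" "nreg \<sigma>5 7 = 0" using R5(2) by (auto simp: phase5_def based_def)
    moreover have "stacked \<sigma>5 ?st" using R5(2) by (simp add: phase5_def)
    moreover have "represents N code es 3 6 7 8 \<sigma>5 (init_state N)"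
      using R5(2) Vmax_Vmin
      unfolding represents_def init_state_def phase5_def min_ok_def max_ok_def nodes_def by auto
    ultimately show ?thesis unfolding linked_def by auto
  qed
  moreover have "nreg \<sigma>5 9 = 1" using R5(2) by (simp add: phase5_def based_def)
  ultimately show ?thesis by blast
qed

section \<open>The time bound in terms of nodes and edges\<close>

lemma card_pos_edges: "card (pos_edges N) = length es + length fs"
proof -
  have "pos_edges N = set es \<union> set fs" "set es \<inter> set fs = {}"
    using Vmin_Vmax by (auto simp: pos_edges_def set_es set_fs)
  thus ?thesis using es(1) fs by (simp add: card_Un_disjoint distinct_card)
qed

lemma card_nodes: "card (nodes N) = length xs + length ys"
proof -
  have "Vmin N \<inter> Vmax N = {}" using Vmin_Vmax by auto
  hence "card (nodes N) = card (set xs) + card (set ys)"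
    by (simp add: nodes_def xs ys card_Un_disjoint)
  thus ?thesis using xs(1) ys(1) by (simp add: distinct_card)
qed

text \<open>The value is \<open>length xs + length ys + 2 * length es + 2 * length fs\<close>. An
  edge out of a min-node counts once as a queue entry and once in the scan of its source; a max-node
  weighs the same whether it starts in the queue or with a positive counter.\<close>

lemma potential_init: "potential (init_state N) \<le> 2 * (card (pos_edges N) + card (nodes N))"
proof -
  let ?A = "{y \<in> Vmax N. card (Pred N y) = 0}" and ?B = "{y \<in> Vmax N. card (Pred N y) > 0}"
  have "set es = Sigma (Vmin N) (Succ N)" by (auto simp: set_es Succ_min)
  hence e: "length es = (\<Sum>x \<in> Vmin N. card (Succ N x))"
    using distinct_card[OF es(1)] by (metis card_SigmaI fin_Vmin finite_Succ)
  have "set fs = Sigma (Vmax N) (Succ N)" by (auto simp: set_fs Succ_max)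
  hence f: "length fs = (\<Sum>y \<in> Vmax N. card (Succ N y))"
    using distinct_card[OF fs] by (metis card_SigmaI fin_Vmax finite_Succ)
  have V: "card (Vmin N) = length xs" "card (Vmax N) = length ys"
    using distinct_card xs ys by metis+
  have "{(z, y). z \<in> Vmin N \<and> y \<in> Vmax N \<and> wt N z y > 0} = set es" by (auto simp: set_es)
  hence E: "card {(z, y). z \<in> Vmin N \<and> y \<in> Vmax N \<and> wt N z y > 0} = length es"
    using distinct_card[OF es(1)] by simp
  have W: "(\<Sum>y \<in> ?A. weight (Node y)) + (\<Sum>y \<in> ?B. weight (Node y)) = length ys + 2 * length fs"
  proof -
    have "(\<Sum>y \<in> Vmax N. weight (Node y)) = (\<Sum>y \<in> Vmax N. 1 + 2 * card (Succ N y))"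
      by (rule sum.cong) (auto simp: weight_def)
    also have "\<dots> = length ys + 2 * length fs"
      by (simp only: sum.distrib f V(2)[symmetric]) (simp add: sum_distrib_left)
    finally have "(\<Sum>y \<in> Vmax N. weight (Node y)) = length ys + 2 * length fs" .
    moreover have "Vmax N = ?A \<union> ?B" "?A \<inter> ?B = {}" by auto
    ultimately show ?thesis
      by (metis (no_types, lifting) fin_Vmax finite_Un sum.union_disjoint)
  qed
  have M: "(\<Sum>x \<in> Vmin N. weight (Node x)) = length xs"
    using Vmin_Vmax V by (simp add: weight_def)
  have "potential (init_state N) = length xs + (\<Sum>y \<in> ?A. weight (Node y)) + length es + length es +
      (\<Sum>y \<in> ?B. weight (Node y))"
    unfolding potential_def init_state_def
    using E M e by (simp add: image_mset.compositionality o_def case_prod_beta weight_def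
        sum_unfold_sum_mset[symmetric] del: card_0_eq card_gt_0_iff)
  thus ?thesis using W by (simp add: card_pos_edges card_nodes)
qed

lemma program_implements:
  assumes "input_memory N code xs ys es fs \<sigma>"
  shows "implements_run (Seq init_prog main_loop) 3 6 7 8 N code es \<sigma>
    (300 * (card (pos_edges N) + card (nodes N)))"
proof -
  let ?p = "Seq init_prog main_loop"
  let ?m = "card (pos_edges N) + card (nodes N)"
  obtain \<sigma>1 where 1: "reach (40 * (length xs + length ys + length es + length fs) + 40) (init_prog, \<sigma>) (Skip, \<sigma>1)"
    "static \<sigma>1" "linked \<sigma>1 (init_state N) 0" "nreg \<sigma>1 9 = 1"
    using init_prog_correct[OF assms] by blast
  have "reach (40 * ?m + 41) (?p, \<sigma>) (main_loop, \<sigma>1)"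
    by (rule reach_mono[OF reach_Seq[OF 1(1)]]) (simp add: card_pos_edges card_nodes)
  then obtain u where u: "u \<le> 40 * ?m + 41" "(small_step ^^ u) (?p, \<sigma>) = (main_loop, \<sigma>1)"
    unfolding reach_def by blast
  have shift: "config_after (u + j) ?p \<sigma> = (small_step ^^ j) (main_loop, \<sigma>1)" for j
    using u(2) by (simp add: config_after_def add.commute[of u] funpow_add)
  from main_run[OF 1(2,3) init_inv 1(4)] obtain n S t T \<sigma>' where
    R: "S 0 = init_state N" "\<forall>i < n. alg_step N (S i) (S (Suc i))" "queue (S n) = {#}"
    "\<forall>i < n. t i < t (Suc i)" "t n \<le> 62 * potential (init_state N)" "T \<le> 8"
    "\<forall>i \<le> n. represents N code es 3 6 7 8 (snd ((small_step ^^ t i) (main_loop, \<sigma>1))) (S i)"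
    "(small_step ^^ (t n + T)) (main_loop, \<sigma>1) = (Skip, \<sigma>')" "represents N code es 3 6 7 8 \<sigma>' (S n)"
    by blast
  \<comment> \<open>There is at least one node, so the additive constants 41 of the initialization
    and 8 of the end are absorbed: 40 + 41 + 2 * 62 + 8 is below 300.\<close>
  have "?m \<ge> 1" using Vmin_ne by (simp add: card_nodes Suc_le_eq xs(2)[symmetric])
  hence le: "u + (t n + T) \<le> 300 * ?m"
  proof -
    have "t n \<le> 62 * (2 * ?m)" using R(5) mult_le_mono2[OF potential_init, of 62] by (rule le_trans)
    moreover have "v + (a + b) \<le> 300 * m" if "a \<le> 62 * (2 * m)" "v \<le> 40 * m + 41" "b \<le> 8" "1 \<le> m"
      for a b v m :: nat using that by linarith
    ultimately show ?thesis using u(1) R(6) \<open>?m \<ge> 1\<close> by blast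
  qed
  \<comment> \<open>The remaining \<open>d\<close> steps idle in \<open>Skip\<close>, so the final
    memory is still there when the full time bound is reached.\<close>
  then obtain d where d: "300 * ?m = d + (u + (t n + T))" using le_Suc_ex add.commute by metis
  have "config_after (u + (t n + T)) ?p \<sigma> = (Skip, \<sigma>')" by (simp only: shift R(8))
  hence "config_after (300 * ?m) ?p \<sigma> = (Skip, \<sigma>')"
    unfolding d config_after_def by (simp add: funpow_add steps_Skip)
  thus ?thesis unfolding implements_run_def using R le
    by (intro exI[of _ n] exI[of _ S] exI[of _ "\<lambda>i. u + t i"]) (simp add: shift)
qed

end

theorem theorem3p3:
  shows "(\<forall>N :: 'v net. finite_minimax_net N \<longrightarrow> alg_returns_greatest N) \<and>
    (\<exists>p aM aD aF aC c. \<forall>(N :: 'v net) code xs ys es fs \<sigma>.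
       finite_minimax_net N \<longrightarrow>
       presentation N code xs ys es fs \<longrightarrow>
       input_memory N code xs ys es fs \<sigma> \<longrightarrow>
       implements_run p aM aD aF aC N code es \<sigma>
         (c * (card (pos_edges N) + card (nodes N))))"
proof
  show "\<forall>N :: 'v net. finite_minimax_net N \<longrightarrow> alg_returns_greatest N"
    using minimax.returns_greatest minimax.intro by blast
next
  have "implements_run (Seq init_prog main_loop) 3 6 7 8 N code es \<sigma>
      (300 * (card (pos_edges N) + card (nodes N)))"
    if "finite_minimax_net N" "presentation N code xs ys es fs" "input_memory N code xs ys es fs \<sigma>"
    for N :: "'v net" and code xs ys es fs \<sigma>
    using that by (intro presented.program_implements presented.intro minimax.intro presented_axioms.intro)
  thus "\<exists>p aM aD aF aC c. \<forall>(N :: 'v net) code xs ys es fs \<sigma>.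
       finite_minimax_net N \<longrightarrow>
       presentation N code xs ys es fs \<longrightarrow>
       input_memory N code xs ys es fs \<sigma> \<longrightarrow>
       implements_run p aM aD aF aC N code es \<sigma>
         (c * (card (pos_edges N) + card (nodes N)))" by blast
qed

end
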